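(* Let $p$ be an odd prime and let $F$ be the field with $p^f$ elements. Let $q$ be an odd prime divisor of $p^f-1$, and write $p^f = sq^m+1$, where $s, m$ are positive integers and $\gcd(s,q)=1$. Let $G$ be the extension of the cyclic group $B=\langle b\rangle$ of order $q$ by an abelian group $A$ of order $p^n$ (so $A$ is normal in $G$ and $G = A\rtimes B$) such that $C_A(b)=\{e\}$. If either $m>1$, or both $s+1\ge q$ and $2n\ge f(q-1)$, then $G$ does not have a normal complement in $V(FG)$.
   Context: $FG$ is the group algebra and $V(FG)$ is the group of units of $FG$ of augmentation $1$, where the augmentation map is $\sum_{g}\alpha_g g\mapsto \sum_g\alpha_g$. $C_A(b)=\{a\in A : ab=ba\}$ and $e$ is the identity element. A normal complement of $G$ in $V(FG)$ is a normal subgroup $N$ of $V(FG)$ with $N\cap G=\{1\}$ and $V(FG)=NG$, i.e. $V(FG)=N\rtimes G$. *)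

theory Defs
  imports
    "HOL-Algebra.Algebra"
    "HOL-Computational_Algebra.Primes"
    "HOL-Library.FuncSet"
begin

definition group_algebra_support ::
  "('f, 'm) ring_scheme \<Rightarrow> ('g, 'n) monoid_scheme \<Rightarrow> ('g \<Rightarrow> 'f) \<Rightarrow> 'g set"
  where "group_algebra_support F G x = {g \<in> carrier G. x g \<noteq> \<zero>\<^bsub>F\<^esub>}"

text \<open>
  The formal sum of the terms \<open>x g \<cdot> g\<close> is represented by its coefficient function \<open>x\<close>,
  extended by \<open>undefined\<close> outside \<open>carrier G\<close> so that equality in the carrier is
  equality of coefficients on \<open>carrier G\<close>. The coefficient of \<open>g\<close> in a product \<open>x y\<close> collects the
  products \<open>x h \<cdot> y k\<close> with \<open>h k = g\<close>; the sum is taken over the support of \<open>x\<close>,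
  because \<open>finsum\<close> over an infinite index set is zero by convention.
\<close>

definition group_algebra ::
  "('f, 'm) ring_scheme \<Rightarrow> ('g, 'n) monoid_scheme \<Rightarrow> ('g \<Rightarrow> 'f) ring"
  where "group_algebra F G =
    \<lparr>carrier = {x \<in> carrier G \<rightarrow>\<^sub>E carrier F. finite (group_algebra_support F G x)},
     monoid.mult = (\<lambda>x y. \<lambda>g\<in>carrier G.
       (\<Oplus>\<^bsub>F\<^esub>h\<in>group_algebra_support F G x. x h \<otimes>\<^bsub>F\<^esub> y (inv\<^bsub>G\<^esub> h \<otimes>\<^bsub>G\<^esub> g))),
     monoid.one = (\<lambda>g\<in>carrier G. if g = \<one>\<^bsub>G\<^esub> then \<one>\<^bsub>F\<^esub> else \<zero>\<^bsub>F\<^esub>),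
     ring.zero = (\<lambda>g\<in>carrier G. \<zero>\<^bsub>F\<^esub>),
     ring.add = (\<lambda>x y. \<lambda>g\<in>carrier G. x g \<oplus>\<^bsub>F\<^esub> y g)\<rparr>"

definition group_algebra_embed ::
  "('f, 'm) ring_scheme \<Rightarrow> ('g, 'n) monoid_scheme \<Rightarrow> 'g \<Rightarrow> ('g \<Rightarrow> 'f)"
  where "group_algebra_embed F G h =
    (\<lambda>g\<in>carrier G. if g = h then \<one>\<^bsub>F\<^esub> else \<zero>\<^bsub>F\<^esub>)"

definition augmentation ::
  "('f, 'm) ring_scheme \<Rightarrow> ('g, 'n) monoid_scheme \<Rightarrow> ('g \<Rightarrow> 'f) \<Rightarrow> 'f"
  where "augmentation F G x = (\<Oplus>\<^bsub>F\<^esub>g\<in>group_algebra_support F G x. x g)"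

definition normalized_units ::
  "('f, 'm) ring_scheme \<Rightarrow> ('g, 'n) monoid_scheme \<Rightarrow> ('g \<Rightarrow> 'f) monoid"
  where "normalized_units F G =
    (units_of (group_algebra F G))
      \<lparr>carrier := {u \<in> Units (group_algebra F G). augmentation F G u = \<one>\<^bsub>F\<^esub>}\<rparr>"

definition centralizer_in :: "('g, 'n) monoid_scheme \<Rightarrow> 'g set \<Rightarrow> 'g \<Rightarrow> 'g set"
  where "centralizer_in G A b = {a \<in> A. a \<otimes>\<^bsub>G\<^esub> b = b \<otimes>\<^bsub>G\<^esub> a}"

definition normal_complement :: "('v, 'n) monoid_scheme \<Rightarrow> 'v set \<Rightarrow> 'v set \<Rightarrow> bool"
  where "normal_complement V H N \<longleftrightarrow>
    N \<lhd> V \<and> N \<inter> H = {\<one>\<^bsub>V\<^esub>} \<and> N <#>\<^bsub>V\<^esub> H = carrier V"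

end

theory Submission
  imports Defs
begin

text \<open>
  A normal complement yields a retraction \<open>\<rho>\<close> of \<open>V = V(FG)\<close> onto \<open>G\<close>.

  Let \<open>A\<close> be nontrivial. As \<open>q\<close> divides \<open>\<bar>F\<bar> - 1\<close>, the algebra \<open>FB\<close> is spanned by orthogonal idempotents
  \<open>e\<^sub>i\<close>, and the involutions \<open>1 - 2 e\<^sub>i\<close> with \<open>i \<noteq> 0\<close> lie in \<open>V\<close>, commute with each other
  and with \<open>b\<close>, and jointly determine the centralizer of \<open>b\<close>. Their images under \<open>\<rho>\<close> centralize \<open>b\<close>,
  hence lie in \<open>B\<close>, which has odd order; so \<open>\<rho>\<close> kills them. The units congruent to \<open>1\<close>
  modulo the nilpotent ideal generated by all \<open>a - 1\<close> with \<open>a \<in> A\<close> form a normal \<open>p\<close>-subgroup \<open>P\<close> of \<open>V\<close>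
  containing \<open>A\<close>. If an involution \<open>w\<close> is killed by \<open>\<rho>\<close> and \<open>x \<in> P\<close>, then
  \<open>k = x\<^sup>-\<^sup>1 w x w\<close> has odd order and is inverted by \<open>w\<close>; with \<open>y\<close> the square root of \<open>k\<close> among its powers,
  \<open>x y\<close> commutes with \<open>w\<close> and has the same image as \<open>x\<close>. Doing this for all involutions replaces \<open>a \<in> A\<close>
  by an element \<open>c\<close> commuting with \<open>b\<close> with \<open>\<rho> c = a\<close>, so that \<open>a \<in> C\<^sub>A(b) = 1\<close>.

  If \<open>A\<close> is trivial, then the hypotheses force \<open>m > 1\<close>. Now \<open>F\<close> contains roots of unity of order \<open>q\<^sup>2\<close>,
  so \<open>b\<close> is a \<open>q\<close>-th power in \<open>V\<close>, and hence in the group \<open>G\<close> of order \<open>q\<close>, which is absurd.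
\<close>

section \<open>Retractions and involutions\<close>

lemma normal_complement_retraction:
  assumes V: "group V" and G: "group G"
    and em: "em \<in> hom G V" "inj_on em (carrier G)"
    and N: "normal_complement V (em ` carrier G) N"
  obtains r where "r \<in> hom V G" "\<And>g. g \<in> carrier G \<Longrightarrow> r (em g) = g"
proof -
  interpret V: group V by fact
  interpret G: group G by fact
  interpret em: group_hom G V em
    by unfold_locales (rule em)
  interpret N: normal N V using N by (simp add: normal_complement_def)
  have NH: "N \<inter> em ` carrier G = {\<one>\<^bsub>V\<^esub>}" and cov: "N <#>\<^bsub>V\<^esub> em ` carrier G = carrier V"
    using N by (auto simp: normal_complement_def)
  \<comment> \<open>The quotient of the two group parts is a product of members of \<open>N\<close>,
    so it lies in the trivial intersection of \<open>N\<close> with the image of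
    \<open>em\<close>.\<close>
  have uniq: "g = h"
    if g: "g \<in> carrier G" "h \<in> carrier G" and nn: "n \<in> N" "n' \<in> N"
      and eq: "n \<otimes>\<^bsub>V\<^esub> em g = n' \<otimes>\<^bsub>V\<^esub> em h" for n n' g h
  proof -
    have nV: "n \<in> carrier V" "n' \<in> carrier V" using nn N.mem_carrier by auto
    have "em (g \<otimes>\<^bsub>G\<^esub> inv\<^bsub>G\<^esub> h) = em g \<otimes>\<^bsub>V\<^esub> inv\<^bsub>V\<^esub> em h"
      using g by simp
    also have "em g = inv\<^bsub>V\<^esub> n \<otimes>\<^bsub>V\<^esub> (n' \<otimes>\<^bsub>V\<^esub> em h)"
      using g nV by (simp add: eq[symmetric] V.inv_solve_left)
    also have "\<dots> \<otimes>\<^bsub>V\<^esub> inv\<^bsub>V\<^esub> em h = inv\<^bsub>V\<^esub> n \<otimes>\<^bsub>V\<^esub> n'"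
      using g nV by (simp add: V.m_assoc)
    finally have "em (g \<otimes>\<^bsub>G\<^esub> inv\<^bsub>G\<^esub> h) \<in> N" using nn by simp
    moreover have "em (g \<otimes>\<^bsub>G\<^esub> inv\<^bsub>G\<^esub> h) \<in> em ` carrier G" using g by (intro imageI) simp
    ultimately have "em (g \<otimes>\<^bsub>G\<^esub> inv\<^bsub>G\<^esub> h) = em \<one>\<^bsub>G\<^esub>" using NH by auto
    then have "g \<otimes>\<^bsub>G\<^esub> inv\<^bsub>G\<^esub> h = \<one>\<^bsub>G\<^esub>" using em(2) g by (metis G.inv_closed G.m_closed G.one_closed inj_onD)
    then show ?thesis using g by (metis G.inv_solve_right' G.l_one G.one_closed)
  qed
  have ex: "\<exists>g n. g \<in> carrier G \<and> n \<in> N \<and> v = n \<otimes>\<^bsub>V\<^esub> em g" if "v \<in> carrier V" for v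
    using that cov unfolding set_mult_def by blast
  define r where "r v = (SOME g. g \<in> carrier G \<and> (\<exists>n\<in>N. v = n \<otimes>\<^bsub>V\<^esub> em g))" for v
  have r: "r v \<in> carrier G" "\<exists>n\<in>N. v = n \<otimes>\<^bsub>V\<^esub> em (r v)" if "v \<in> carrier V" for v
    using someI_ex[of "\<lambda>g. g \<in> carrier G \<and> (\<exists>n\<in>N. v = n \<otimes>\<^bsub>V\<^esub> em g)"] ex[OF that]
    unfolding r_def by blast+
  have rI: "r (n \<otimes>\<^bsub>V\<^esub> em g) = g" if "n \<in> N" "g \<in> carrier G" for n g
  proof -
    have "n \<otimes>\<^bsub>V\<^esub> em g \<in> carrier V" using that N.mem_carrier by simp
    from r[OF this] show ?thesis using uniq that by metis
  qed
  show thesis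
  proof
    show "r \<in> hom V G"
    proof (rule homI)
      fix u v assume uv: "u \<in> carrier V" "v \<in> carrier V"
      obtain n g where u: "u = n \<otimes>\<^bsub>V\<^esub> em g" "n \<in> N" "g \<in> carrier G" using ex uv by blast
      obtain n' g' where v: "v = n' \<otimes>\<^bsub>V\<^esub> em g'" "n' \<in> N" "g' \<in> carrier G" using ex uv by blast
      \<comment> \<open>Moving \<open>em g\<close> past \<open>n'\<close> replaces \<open>n'\<close>
        by its conjugate, which stays in \<open>N\<close>; what remains is again of the form
        accepted by \<open>rI\<close>.\<close>
      have "u \<otimes>\<^bsub>V\<^esub> v
          = (n \<otimes>\<^bsub>V\<^esub> (em g \<otimes>\<^bsub>V\<^esub> n' \<otimes>\<^bsub>V\<^esub> inv\<^bsub>V\<^esub> em g)) \<otimes>\<^bsub>V\<^esub> em (g \<otimes>\<^bsub>G\<^esub> g')"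
      proof -
        have n: "n \<in> carrier V" "n' \<in> carrier V" using u v N.mem_carrier by auto
        have "inv\<^bsub>V\<^esub> em g \<otimes>\<^bsub>V\<^esub> (em g \<otimes>\<^bsub>V\<^esub> em g') = em g'"
          using u(3) v(3) by (simp add: V.m_assoc[symmetric])
        then show ?thesis
          using n u(3) v(3) by (simp add: u(1) v(1) V.m_assoc)
      qed
      moreover have "n \<otimes>\<^bsub>V\<^esub> (em g \<otimes>\<^bsub>V\<^esub> n' \<otimes>\<^bsub>V\<^esub> inv\<^bsub>V\<^esub> em g) \<in> N"
        using u v N.inv_op_closed2 by simp
      ultimately show "r (u \<otimes>\<^bsub>V\<^esub> v) = r u \<otimes>\<^bsub>G\<^esub> r v"
        using u(1,3) v(1,3) rI by (metis G.m_closed rI u(2) v(2))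
    qed (use r in auto)
    fix g assume g: "g \<in> carrier G"
    then show "r (em g) = g" using rI[of "\<one>\<^bsub>V\<^esub>" g] by simp
  qed
qed

text \<open>A correction of \<open>x\<close> by an element of the kernel moves it into the
  centralizer of the involution \<open>w\<close>. The last clause keeps every commutation that
  \<open>x\<close> already had with elements centralizing \<open>w\<close>, so that several
  commuting involutions can be treated in turn.\<close>

lemma (in group_hom) commuting_lift_step:
  assumes P: "P \<lhd> G" and odd: "\<And>x. x \<in> P \<Longrightarrow> \<exists>d::nat. odd d \<and> x [^] d = \<one>"
    and w: "w \<in> carrier G" "w \<otimes> w = \<one>" "h w = \<one>\<^bsub>H\<^esub>" and x: "x \<in> P"
  shows "\<exists>c\<in>P. h c = h x \<and> w \<otimes> c = c \<otimes> w \<and>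
    (\<forall>v\<in>carrier G. v \<otimes> w = w \<otimes> v \<longrightarrow> v \<otimes> x = x \<otimes> v \<longrightarrow> v \<otimes> c = c \<otimes> v)"
proof -
  interpret P: normal P G by fact
  have xG: "x \<in> carrier G" using x P.mem_carrier by simp
  have iw: "inv w = w" using G.inv_equality[of w w] w by simp
  \<comment> \<open>As \<open>w\<close> is its own inverse, this is a commutator of \<open>x\<close>
    and \<open>w\<close>. It lies in \<open>P\<close> by normality and in the kernel of
    \<open>h\<close> because \<open>h w\<close> is trivial.\<close>
  define k where "k = inv x \<otimes> (w \<otimes> x \<otimes> w)"
  have kP: "k \<in> P" using P.inv_op_closed2[OF w(1) x] x by (simp add: k_def iw)
  have kG: "k \<in> carrier G" using kP P.mem_carrier by simp
  have xk: "x \<otimes> k = w \<otimes> x \<otimes> w"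
    using xG w by (simp add: k_def G.m_assoc[symmetric])
  have ww: "w \<otimes> (w \<otimes> z) = z" if "z \<in> carrier G" for z
    using w that by (simp add: G.m_assoc[symmetric])
  have wkw: "w \<otimes> k \<otimes> w = inv k"
  proof -
    have "inv k = w \<otimes> (inv x \<otimes> w) \<otimes> x"
      using xG w by (simp add: k_def G.inv_mult_group iw G.m_assoc)
    then show ?thesis
      using xG w by (simp add: k_def G.m_assoc ww)
  qed
  obtain d :: nat where d: "odd d" "k [^] d = \<one>" using odd[OF kP] by blast
  \<comment> \<open>With \<open>d\<close> odd, twice \<open>Suc d div 2\<close> is
    \<open>d + 1\<close>, and \<open>k\<close> to the power \<open>d + 1\<close> is
    \<open>k\<close>; hence \<open>y\<close> is a square root of \<open>k\<close>.\<close>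
  define y where "y = k [^] (Suc d div 2)"
  have "k [^] j \<in> P" for j :: nat using kP by (induction j) simp_all
  then have yP: "y \<in> P" by (simp add: y_def)
  then have yG: "y \<in> carrier G" using P.mem_carrier by simp
  have yy: "y \<otimes> y = k"
  proof -
    have "y \<otimes> y = k [^] (Suc d div 2 + Suc d div 2)"
      using kG by (simp add: y_def G.nat_pow_mult)
    also have "Suc d div 2 + Suc d div 2 = Suc d" using d(1) by presburger
    finally show ?thesis using d kG by simp
  qed
  have conj: "w \<otimes> (k [^] j) \<otimes> w = inv (k [^] j)" for j :: nat
  proof (induction j)
    case (Suc j)
    have "w \<otimes> k [^] Suc j \<otimes> w = (w \<otimes> k [^] j \<otimes> w) \<otimes> (w \<otimes> k \<otimes> w)"
      using kG w by (simp add: G.m_assoc ww)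
    also have "\<dots> = inv (k [^] Suc j)"
      using kG by (simp only: Suc wkw) (simp add: G.inv_mult_group[symmetric] G.nat_pow_Suc2[symmetric])
    finally show ?case .
  qed (use w in simp)
  have hk: "h k = \<one>\<^bsub>H\<^esub>" using xG w by (simp add: k_def)
  have hy: "h y = \<one>\<^bsub>H\<^esub>" using hk kG by (simp add: y_def hom_nat_pow)
  define c where "c = x \<otimes> y"
  have "c \<in> P" using x yP by (simp add: c_def)
  moreover have "h c = h x" using xG yG hy by (simp add: c_def)
  moreover have "w \<otimes> c = c \<otimes> w"
  proof -
    \<comment> \<open>Conjugation by \<open>w\<close> sends \<open>x\<close> to \<open>x k\<close>
      and inverts \<open>y\<close>, so \<open>x y\<close> goes to \<open>x k\<close> times the
      inverse of \<open>y\<close>, which is \<open>x y\<close> because \<open>k\<close> is the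
      square of \<open>y\<close>.\<close>
    have "w \<otimes> c \<otimes> w = (w \<otimes> x \<otimes> w) \<otimes> (w \<otimes> y \<otimes> w)"
      using xG yG w by (simp add: c_def G.m_assoc ww)
    also have "\<dots> = x \<otimes> (y \<otimes> y) \<otimes> inv y"
      unfolding xk[symmetric] yy using conj by (simp add: y_def)
    also have "\<dots> = c" using xG yG by (simp add: c_def G.m_assoc)
    finally have "w \<otimes> c \<otimes> w = c" .
    then show ?thesis using xG yG w by (metis c_def G.m_assoc G.m_closed G.r_one)
  qed
  moreover have "v \<otimes> c = c \<otimes> v"
    if v: "v \<in> carrier G" "v \<otimes> w = w \<otimes> v" "v \<otimes> x = x \<otimes> v" for v
  proof -
    have vx: "v \<otimes> inv x = inv x \<otimes> v"
      using v xG by (metis G.inv_closed G.inv_solve_left G.inv_solve_right G.m_assoc G.m_closed)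
    have "v \<otimes> k = k \<otimes> v"
    proof -
      have "v \<otimes> k = inv x \<otimes> v \<otimes> w \<otimes> x \<otimes> w" using v w xG
        by (simp add: k_def G.m_assoc[symmetric] vx)
      also have "\<dots> = inv x \<otimes> w \<otimes> (v \<otimes> x) \<otimes> w" using v w xG by (simp add: G.m_assoc)
      also have "\<dots> = inv x \<otimes> w \<otimes> x \<otimes> (v \<otimes> w)" using v w xG by (simp add: v(3) G.m_assoc)
      also have "\<dots> = k \<otimes> v" using v w xG by (simp add: v(2) k_def G.m_assoc)
      finally show ?thesis .
    qed
    then have "v \<otimes> y = y \<otimes> v"
      unfolding y_def using G.group_commutes_pow[of k v] v kG by metis
    then show ?thesis using v xG yG by (metis c_def G.m_assoc)
  qed
  ultimately show ?thesis by blast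
qed

text \<open>Induction over \<open>W\<close>: the element found for the smaller set is corrected for
  the new involution \<open>w\<close>, and since the members of \<open>W\<close> commute with
  \<open>w\<close>, the correction does not destroy what was achieved for them.\<close>

lemma (in group_hom) commuting_lift:
  assumes P: "P \<lhd> G" and odd: "\<And>x. x \<in> P \<Longrightarrow> \<exists>d::nat. odd d \<and> x [^] d = \<one>"
    and W: "finite W" "W \<subseteq> carrier G" "\<And>w. w \<in> W \<Longrightarrow> w \<otimes> w = \<one>" "\<And>w. w \<in> W \<Longrightarrow> h w = \<one>\<^bsub>H\<^esub>"
      "\<And>v w. v \<in> W \<Longrightarrow> w \<in> W \<Longrightarrow> v \<otimes> w = w \<otimes> v"
    and x: "x \<in> P"
  shows "\<exists>c\<in>P. h c = h x \<and> (\<forall>w\<in>W. w \<otimes> c = c \<otimes> w)"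
  using W
proof (induction W rule: finite_induct)
  case empty
  then show ?case using x by auto
next
  case (insert w W)
  then obtain c where c: "c \<in> P" "h c = h x" "\<And>v. v \<in> W \<Longrightarrow> v \<otimes> c = c \<otimes> v" by auto
  have w: "w \<in> carrier G" "w \<otimes> w = \<one>" "h w = \<one>\<^bsub>H\<^esub>" using insert.prems by auto
  obtain c' where c': "c' \<in> P" "h c' = h c" "w \<otimes> c' = c' \<otimes> w"
    "\<And>v. v \<in> carrier G \<Longrightarrow> v \<otimes> w = w \<otimes> v \<Longrightarrow> v \<otimes> c = c \<otimes> v \<Longrightarrow> v \<otimes> c' = c' \<otimes> v"
    using commuting_lift_step[OF P odd w c(1)] by blast
  moreover have "v \<otimes> c' = c' \<otimes> v" if "v \<in> insert w W" for v
    using that c' c insert.prems by auto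
  ultimately show ?case using c by metis
qed

section \<open>Nilpotent ideals in prime characteristic\<close>

text \<open>The summands \<open>\<one>\<close> and \<open>y\<close> commute, so Pascal's rule proves
  the binomial formula in an arbitrary ring. Group algebras of nonabelian groups are the intended
  application.\<close>

lemma (in ring) binomial_one_plus:
  assumes y: "y \<in> carrier R"
  shows "(\<one> \<oplus> y) [^] (m::nat) = (\<Oplus>k\<in>{..m}. [(m choose k)] \<cdot> (y [^] k))"
proof (induction m)
  case 0
  then show ?case by simp
next
  case (Suc m)
  let ?t = "\<lambda>m k. [(m choose k)] \<cdot> (y [^] k)"
  let ?s = "\<Oplus>k\<in>{..m}. [(m choose k)] \<cdot> (y [^] Suc k)"
  have "(\<one> \<oplus> y) [^] Suc m = (\<Oplus>k\<in>{..m}. ?t m k) \<oplus> (\<Oplus>k\<in>{..m}. ?t m k) \<otimes> y"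
    using y by (simp add: Suc r_distr)
  also have "(\<Oplus>k\<in>{..m}. ?t m k) \<otimes> y = ?s"
    using y by (subst finsum_ldistr) (auto simp: add_pow_ldistr intro!: finsum_cong')
  \<comment> \<open>The added term has binomial coefficient zero. After the term for 0 is split off,
    both sums run over the same indices and Pascal's rule applies termwise.\<close>
  also have "(\<Oplus>k\<in>{..m}. ?t m k) = (\<Oplus>k\<in>{..Suc m}. ?t m k)"
    using y by (subst finsum_Suc) (auto simp: binomial_eq_0)
  also have "\<dots> = (\<Oplus>k\<in>{..m}. ?t m (Suc k)) \<oplus> ?t m 0"
    using y by (subst finsum_Suc2) auto
  also have "\<dots> \<oplus> ?s = (\<Oplus>k\<in>{..m}. ?t m (Suc k)) \<oplus> ?s \<oplus> ?t m 0"
    using y by (auto intro!: a_ac finsum_closed) (simp add: add.m_ac finsum_closed)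
  also have "(\<Oplus>k\<in>{..m}. ?t m (Suc k)) \<oplus> ?s = (\<Oplus>k\<in>{..m}. ?t (Suc m) (Suc k))"
    using y by (subst finsum_addf[symmetric])
      (auto simp: add.nat_pow_mult add.commute intro!: finsum_cong')
  also have "\<dots> \<oplus> ?t m 0 = (\<Oplus>k\<in>{..Suc m}. ?t (Suc m) k)"
    using y by (subst finsum_Suc2) auto
  finally show ?case .
qed

text \<open>The inner binomial coefficients of a \<open>p\<close>-th power are divisible by
  \<open>p\<close> and vanish in the ring; iterating this for \<open>z = y [^] (p ^ j)\<close> gives
  all powers of \<open>p\<close>.\<close>

lemma (in ring) freshman:
  assumes y: "y \<in> carrier R" and p: "Factorial_Ring.prime (p::nat)" and char: "[p] \<cdot> \<one> = \<zero>"
  shows "(\<one> \<oplus> y) [^] (p ^ j) = \<one> \<oplus> y [^] (p ^ j)"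
proof (induction j)
  case 0
  then show ?case using y by simp
next
  case (Suc j)
  define z where "z = y [^] (p ^ j)"
  have z: "z \<in> carrier R" using y by (simp add: z_def)
  have p0: "p > 0" using p prime_gt_0_nat by blast
  have van: "[(p choose k)] \<cdot> (z [^] k) = \<zero>" if k: "k \<in> {..p} - {0,p}" for k
  proof -
    have "p dvd (p choose k)" using k p by (intro dvd_choose_prime) auto
    then obtain c where c: "p choose k = p * c" by (auto elim: dvdE)
    have "[(p choose k)] \<cdot> (z [^] k) = [c] \<cdot> ([p] \<cdot> (z [^] k))"
      using z by (simp add: c add.nat_pow_pow)
    also have "[p] \<cdot> (z [^] k) = ([p] \<cdot> \<one>) \<otimes> z [^] k"
      using z by (simp add: add_pow_ldistr)
    finally show ?thesis using z by (simp add: char)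
  qed
  have "(\<one> \<oplus> y) [^] (p ^ Suc j) = (\<one> \<oplus> z) [^] p"
    using y by (simp add: z_def Suc[symmetric] nat_pow_pow mult.commute)
  also have "\<dots> = (\<Oplus>k\<in>{..p}. [(p choose k)] \<cdot> (z [^] k))"
    by (rule binomial_one_plus[OF z])
  also have "\<dots> = (\<Oplus>k\<in>{0,p}. [(p choose k)] \<cdot> (z [^] k))"
    using z van by (intro add.finprod_mono_neutral_cong_right) auto
  also have "\<dots> = \<one> \<oplus> z [^] p" using z p0 by simp
  also have "z [^] p = y [^] (p ^ Suc j)"
    using y by (simp add: z_def nat_pow_pow mult.commute)
  finally show ?case .
qed

section \<open>Left ideals and nil two-sided ideals\<close>

definition left_ideal :: "'a set \<Rightarrow> ('a, 'b) ring_scheme \<Rightarrow> bool" where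
  "left_ideal K R \<longleftrightarrow> K \<subseteq> carrier R \<and> \<zero>\<^bsub>R\<^esub> \<in> K \<and> (\<forall>x\<in>K. \<forall>y\<in>K. x \<oplus>\<^bsub>R\<^esub> y \<in> K) \<and>
    (\<forall>r\<in>carrier R. \<forall>x\<in>K. r \<otimes>\<^bsub>R\<^esub> x \<in> K)"

text \<open>Negatives come from left multiplication by the negative of
  \<open>\<one>\<close>.\<close>

lemma (in ring) left_ideal_subgroup:
  assumes "left_ideal K R"
  shows "subgroup K (add_monoid R)"
proof -
  have "\<ominus> x \<in> K" if "x \<in> K" for x
  proof -
    have "\<ominus> \<one> \<otimes> x \<in> K" and "x \<in> carrier R" using assms that unfolding left_ideal_def by auto
    then show ?thesis by (simp add: l_minus)
  qed
  then show ?thesis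
    using assms unfolding left_ideal_def subgroup_def by (auto simp: a_inv_def)
qed

text \<open>These elements annihilate the class of \<open>x\<close> modulo \<open>K\<close>. Passing
  to this left ideal turns a statement about all left ideals containing \<open>S\<close> into one
  about products with \<open>x\<close>.\<close>

lemma (in ring) left_ideal_colon:
  assumes "left_ideal K R" "x \<in> carrier R"
  shows "left_ideal {z \<in> carrier R. z \<otimes> x \<in> K} R"
  using assms unfolding left_ideal_def by (auto simp: l_distr m_assoc)

text \<open>Commuting nilpotent operators on the nonzero module \<open>R/K\<close> have a common
  nonzero kernel vector. For one more operator \<open>d\<close>, the vector found so far is
  multiplied by the last power of \<open>d\<close> that keeps it nonzero; since \<open>d\<close>
  commutes with the others, they still kill it.\<close>

lemma (in ring) nilpotent_common_annihilated:
  assumes "finite S" and "S \<subseteq> carrier R"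
    and "\<And>d d'. d \<in> S \<Longrightarrow> d' \<in> S \<Longrightarrow> d \<otimes> d' = d' \<otimes> d"
    and "\<And>d. d \<in> S \<Longrightarrow> \<exists>N::nat. d [^] N = \<zero>"
    and K: "left_ideal K R" and one: "\<one> \<notin> K"
  shows "\<exists>x\<in>carrier R - K. \<forall>d\<in>S. d \<otimes> x \<in> K"
  using assms(1-4)
proof (induction S rule: finite_induct)
  case empty
  then show ?case using one by auto
next
  case (insert d S)
  then obtain x where x: "x \<in> carrier R" "x \<notin> K" "\<And>d. d \<in> S \<Longrightarrow> d \<otimes> x \<in> K" by auto
  have d: "d \<in> carrier R" using insert.prems by simp
  have K0: "\<zero> \<in> K" and Km: "\<And>r z. r \<in> carrier R \<Longrightarrow> z \<in> K \<Longrightarrow> r \<otimes> z \<in> K"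
    using K unfolding left_ideal_def by auto
  obtain N :: nat where N: "d [^] N = \<zero>" using insert.prems(3)[of d] by auto
  \<comment> \<open>The minimum exists because \<open>d\<close> is nilpotent, and it is positive
    because \<open>x\<close> lies outside \<open>K\<close>; the witness uses the exponent just below
    it.\<close>
  define i where "i = (LEAST i::nat. d [^] i \<otimes> x \<in> K)"
  have iK: "d [^] i \<otimes> x \<in> K"
    unfolding i_def by (rule LeastI[of _ N]) (use N x K0 in simp)
  have "i \<noteq> 0" using iK x by (intro notI) simp
  then obtain j where j: "i = Suc j" by (cases i) auto
  define z where "z = d [^] j \<otimes> x"
  have "z \<notin> K" using not_less_Least[of j "\<lambda>i. d [^] i \<otimes> x \<in> K"] j by (simp add: z_def i_def)
  moreover have "z \<in> carrier R" using d x by (simp add: z_def)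
  moreover have "d' \<otimes> z \<in> K" if "d' \<in> insert d S" for d'
  proof (cases "d' = d")
    case True
    then show ?thesis using iK d x by (simp add: j z_def m_assoc[symmetric] nat_pow_Suc2[symmetric])
  next
    case False
    then have d': "d' \<in> S" "d' \<in> carrier R" using that insert.prems by auto
    have "d' \<otimes> d [^] j = d [^] j \<otimes> d'"
      using group_commutes_pow[of d d' j] insert.prems(2)[of d d'] d d' by auto
    then have "d' \<otimes> z = d [^] j \<otimes> (d' \<otimes> x)"
      using d d' x by (simp add: z_def m_assoc[symmetric])
    then show ?thesis using Km x d' d by simp
  qed
  ultimately show ?case by blast
qed

text \<open>The assumption \<open>normal\<close> says that \<open>S\<close> can be moved from the
  left of a ring element to the right: the products \<open>d r\<close> lie in the left ideal
  generated by \<open>S\<close>. This lets one-sided annihilation by \<open>S\<close> control the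
  two-sided ideal.\<close>

lemma (in ring) nil_genideal:
  assumes fin: "finite (carrier R)" and S: "S \<subseteq> carrier R"
    and comm: "\<And>d d'. d \<in> S \<Longrightarrow> d' \<in> S \<Longrightarrow> d \<otimes> d' = d' \<otimes> d"
    and nil: "\<And>d. d \<in> S \<Longrightarrow> \<exists>N::nat. d [^] N = \<zero>"
    and normal: "\<And>K d r. left_ideal K R \<Longrightarrow> S \<subseteq> K \<Longrightarrow> d \<in> S \<Longrightarrow> r \<in> carrier R \<Longrightarrow> d \<otimes> r \<in> K"
    and y: "y \<in> Idl S"
  shows "\<exists>N::nat. y [^] N = \<zero>"
proof -
  interpret I: ideal "Idl S" R using genideal_ideal[OF S] .
  have yR: "y \<in> carrier R" using y I.Icarr by simp
  \<comment> \<open>\<open>K\<close> collects the \<open>x\<close> for which a single power of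
    \<open>y\<close> kills the whole left ideal of multiples of \<open>x\<close>. The goal is
    \<open>\<one> \<in> K\<close>, which makes \<open>y\<close> nilpotent.\<close>
  define K where "K = {x \<in> carrier R. \<exists>N::nat. \<forall>r\<in>carrier R. y [^] N \<otimes> (r \<otimes> x) = \<zero>}"
  have mono: "y [^] M \<otimes> (r \<otimes> x) = \<zero>"
    if "y [^] N \<otimes> (r \<otimes> x) = \<zero>" "N \<le> M" "x \<in> carrier R" "r \<in> carrier R" for N M :: nat and x r
  proof -
    have "y [^] M = y [^] (M - N) \<otimes> y [^] N" using that yR by (simp add: nat_pow_mult)
    then show ?thesis using that yR by (simp add: m_assoc)
  qed
  have K: "left_ideal K R"
    unfolding left_ideal_def
  proof (intro conjI ballI)
    fix x x' assume "x \<in> K" "x' \<in> K"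
    then obtain N N' where N: "x \<in> carrier R" "x' \<in> carrier R"
      "\<And>r. r \<in> carrier R \<Longrightarrow> y [^] (N::nat) \<otimes> (r \<otimes> x) = \<zero>"
      "\<And>r. r \<in> carrier R \<Longrightarrow> y [^] (N'::nat) \<otimes> (r \<otimes> x') = \<zero>" unfolding K_def by blast
    have "y [^] (max N N') \<otimes> (r \<otimes> (x \<oplus> x')) = \<zero>" if "r \<in> carrier R" for r
      using mono[OF N(3) _ N(1), of r "max N N'"] mono[OF N(4) _ N(2), of r "max N N'"] that N(1,2) yR
      by (simp add: r_distr)
    then show "x \<oplus> x' \<in> K" using N(1,2) unfolding K_def by blast
  next
    fix r x assume r: "r \<in> carrier R" "x \<in> K"
    then obtain N where "x \<in> carrier R"
      "\<And>r. r \<in> carrier R \<Longrightarrow> y [^] (N::nat) \<otimes> (r \<otimes> x) = \<zero>" unfolding K_def by blast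
    then show "r \<otimes> x \<in> K" using r(1) unfolding K_def
      by (auto simp: m_assoc[symmetric] intro!: exI[of _ N])
  qed (use yR in \<open>auto simp: K_def\<close>)
  have "\<one> \<in> K"
  proof (rule ccontr)
    assume "\<one> \<notin> K"
    then obtain x where x: "x \<in> carrier R" "x \<notin> K" "\<And>d. d \<in> S \<Longrightarrow> d \<otimes> x \<in> K"
      using nilpotent_common_annihilated[OF finite_subset[OF S fin] S comm nil K] by blast
    \<comment> \<open>These are the vectors that \<open>S\<close> kills modulo \<open>K\<close>. By
      \<open>normal\<close>, applied to the colon ideal of \<open>t\<close>, this set is stable
      under left multiplication by all of the ring.\<close>
    define T where "T = {x \<in> carrier R. \<forall>d\<in>S. d \<otimes> x \<in> K}"
    have T: "r \<otimes> t \<in> T" if "r \<in> carrier R" "t \<in> T" for r t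
    proof -
      have t: "t \<in> carrier R" "\<And>d. d \<in> S \<Longrightarrow> d \<otimes> t \<in> K" using that by (auto simp: T_def)
      have "d \<otimes> r \<otimes> t \<in> K" if "d \<in> S" for d
        using normal[OF left_ideal_colon[OF K t(1)], of d r] t S that \<open>r \<in> carrier R\<close> by auto
      then show ?thesis using that t S by (auto simp: T_def m_assoc subset_iff)
    qed
    \<comment> \<open>Stability of \<open>T\<close> makes this annihilator two-sided. It contains
      \<open>S\<close>, hence the whole ideal generated by \<open>S\<close>, in particular all
      products \<open>y r\<close>.\<close>
    define J where "J = {z \<in> carrier R. \<forall>t\<in>T. z \<otimes> t \<in> K}"
    have TR: "T \<subseteq> carrier R" by (auto simp: T_def)
    have "left_ideal J R"
      using K TR unfolding left_ideal_def J_def by (auto simp: l_distr m_assoc subset_iff)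
    then have "ideal J R"
      using T TR by (intro idealI left_ideal_subgroup)
        (auto simp: left_ideal_def ring_axioms, auto simp: J_def m_assoc subset_iff)
    moreover have "S \<subseteq> J" using S by (auto simp: J_def T_def)
    ultimately have IJ: "Idl S \<subseteq> J" by (rule genideal_minimal)
    have "\<exists>N::nat. y [^] N \<otimes> (y \<otimes> (r \<otimes> x)) = \<zero>" if r: "r \<in> carrier R" for r
    proof -
      have "y \<otimes> r \<in> J" using IJ I.I_r_closed[OF y r] by blast
      then have "y \<otimes> r \<otimes> x \<in> K" using x by (auto simp: J_def T_def)
      then obtain N :: nat where "y [^] N \<otimes> (\<one> \<otimes> (y \<otimes> r \<otimes> x)) = \<zero>" unfolding K_def by blast
      then show ?thesis using yR r x(1) by (auto simp: m_assoc)
    qed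
    then obtain N :: "_ \<Rightarrow> nat" where N: "\<And>r. r \<in> carrier R \<Longrightarrow> y [^] N r \<otimes> (y \<otimes> (r \<otimes> x)) = \<zero>"
      by metis
    \<comment> \<open>The exponent \<open>N r\<close> still depends on \<open>r\<close>; finiteness
      of the ring supplies a uniform one, which puts \<open>x\<close> into \<open>K\<close> against
      its choice.\<close>
    have "y [^] Suc (Max (N ` carrier R)) \<otimes> (r \<otimes> x) = \<zero>" if r: "r \<in> carrier R" for r
    proof (rule mono)
      show "y [^] Suc (N r) \<otimes> (r \<otimes> x) = \<zero>" using N[OF r] yR x r by (simp add: m_assoc)
      show "Suc (N r) \<le> Suc (Max (N ` carrier R))" using fin r by simp
    qed (use x r in auto)
    then have "x \<in> K" using x unfolding K_def by blast
    then show False using x by simp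
  qed
  then obtain N :: nat where "y [^] N \<otimes> (\<one> \<otimes> \<one>) = \<zero>" unfolding K_def by blast
  then show ?thesis using yR by auto
qed

text \<open>The exponent \<open>p ^ N\<close> is at least \<open>N\<close>, so \<open>y\<close>
  raised to it vanishes and \<open>freshman\<close> leaves only \<open>\<one>\<close>.\<close>

lemma (in ring) unipotent_pow:
  assumes y: "y \<in> carrier R" "y [^] (N::nat) = \<zero>"
    and p: "Factorial_Ring.prime (p::nat)" and char: "[p] \<cdot> \<one> = \<zero>"
  shows "\<exists>j. (\<one> \<oplus> y) [^] (p ^ j) = \<one>"
proof -
  have "N \<le> p ^ N" using less_exp[of N] power_mono[of 2 p N] prime_ge_2_nat[OF p] by linarith
  then have "y [^] (p ^ N) = y [^] N \<otimes> y [^] (p ^ N - N)" using y(1) by (simp add: nat_pow_mult)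
  also have "\<dots> = \<zero>" using y by simp
  finally have "y [^] (p ^ N) = \<zero>" .
  then show ?thesis using freshman[OF y(1) p char, of N] y by (intro exI[of _ N]) simp
qed

section \<open>Group algebras of finite groups\<close>

lemma (in abelian_monoid) finsum_swap:
  assumes "finite A" "finite B" "\<And>a b. a \<in> A \<Longrightarrow> b \<in> B \<Longrightarrow> f a b \<in> carrier G"
  shows "(\<Oplus>a\<in>A. \<Oplus>b\<in>B. f a b) = (\<Oplus>b\<in>B. \<Oplus>a\<in>A. f a b)"
  using assms(1,3)
proof (induction A rule: finite_induct)
  case empty
  then show ?case by simp
next
  case (insert a A)
  have c: "(\<lambda>a. \<Oplus>b\<in>B. f a b) \<in> A \<rightarrow> carrier G" "(\<Oplus>b\<in>B. f a b) \<in> carrier G"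
    using insert.prems by (auto intro!: finsum_closed)
  have "(\<Oplus>b\<in>B. \<Oplus>a\<in>insert a A. f a b) = (\<Oplus>b\<in>B. f a b \<oplus> (\<Oplus>a\<in>A. f a b))"
    using insert by (intro finsum_cong') (auto intro!: finsum_closed finsum_insert)
  also have "\<dots> = (\<Oplus>b\<in>B. f a b) \<oplus> (\<Oplus>b\<in>B. \<Oplus>a\<in>A. f a b)"
    using insert.prems by (intro finsum_addf) (auto intro!: finsum_closed)
  finally show ?case using insert c by simp
qed

text \<open>With \<open>G\<close> finite, sums over supports may be extended to sums over all of
  \<open>carrier G\<close>, which can be reindexed and interchanged freely.\<close>

locale finite_group_algebra = F: field F + G: group G
  for F :: "('f, 'm) ring_scheme" and G :: "('g, 'n) monoid_scheme" +
  assumes fin: "finite (carrier G)"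
begin

abbreviation "R \<equiv> group_algebra F G"

lemma carrier_R: "carrier R = carrier G \<rightarrow>\<^sub>E carrier F"
  using fin by (auto simp: group_algebra_def group_algebra_support_def)

lemma coeff_closed [simp]: "x \<in> carrier R \<Longrightarrow> g \<in> carrier G \<Longrightarrow> x g \<in> carrier F"
  by (auto simp: carrier_R)

lemma R_eqI:
  assumes "x \<in> carrier R" "y \<in> carrier R" "\<And>g. g \<in> carrier G \<Longrightarrow> x g = y g"
  shows "x = y"
  using assms unfolding carrier_R by (rule PiE_ext)

lemma mult_coeff:
  assumes x: "x \<in> carrier R" and y: "y \<in> carrier R" and g: "g \<in> carrier G"
  shows "(x \<otimes>\<^bsub>R\<^esub> y) g = (\<Oplus>\<^bsub>F\<^esub>h\<in>carrier G. x h \<otimes>\<^bsub>F\<^esub> y (inv\<^bsub>G\<^esub> h \<otimes>\<^bsub>G\<^esub> g))"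
proof -
  have "(\<Oplus>\<^bsub>F\<^esub>h\<in>group_algebra_support F G x. x h \<otimes>\<^bsub>F\<^esub> y (inv\<^bsub>G\<^esub> h \<otimes>\<^bsub>G\<^esub> g))
      = (\<Oplus>\<^bsub>F\<^esub>h\<in>carrier G. x h \<otimes>\<^bsub>F\<^esub> y (inv\<^bsub>G\<^esub> h \<otimes>\<^bsub>G\<^esub> g))"
    using x y g fin
    by (intro F.add.finprod_mono_neutral_cong_left) (auto simp: group_algebra_support_def)
  then show ?thesis using g by (simp add: group_algebra_def)
qed

lemma add_coeff [simp]: "g \<in> carrier G \<Longrightarrow> (x \<oplus>\<^bsub>R\<^esub> y) g = x g \<oplus>\<^bsub>F\<^esub> y g"
  by (simp add: group_algebra_def)

lemma zero_coeff [simp]: "g \<in> carrier G \<Longrightarrow> \<zero>\<^bsub>R\<^esub> g = \<zero>\<^bsub>F\<^esub>"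
  by (simp add: group_algebra_def)

text \<open>The element \<open>c h\<close> of the group algebra. Taking \<open>h\<close> to be the
  identity gives the scalars, taking \<open>c\<close> to be one gives the embedded group
  elements.\<close>

definition monomial :: "'f \<Rightarrow> 'g \<Rightarrow> 'g \<Rightarrow> 'f" where
  "monomial c h = (\<lambda>g\<in>carrier G. if g = h then c else \<zero>\<^bsub>F\<^esub>)"

lemma monomial_coeff:
  "g \<in> carrier G \<Longrightarrow> monomial c h g = (if g = h then c else \<zero>\<^bsub>F\<^esub>)"
  by (simp add: monomial_def)

lemma monomial_closed [simp]: "c \<in> carrier F \<Longrightarrow> monomial c h \<in> carrier R"
  by (auto simp: carrier_R monomial_def)

lemma one_monomial: "\<one>\<^bsub>R\<^esub> = monomial \<one>\<^bsub>F\<^esub> \<one>\<^bsub>G\<^esub>"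
  by (simp add: group_algebra_def monomial_def)

lemma embed_monomial: "group_algebra_embed F G h = monomial \<one>\<^bsub>F\<^esub> h"
  by (simp add: group_algebra_embed_def monomial_def)

lemma R_closed [simp]:
  "x \<in> carrier R \<Longrightarrow> y \<in> carrier R \<Longrightarrow> x \<oplus>\<^bsub>R\<^esub> y \<in> carrier R" "\<zero>\<^bsub>R\<^esub> \<in> carrier R"
  "\<one>\<^bsub>R\<^esub> \<in> carrier R"
  unfolding carrier_R by (auto simp: group_algebra_def PiE_mem)

lemma mult_closed [simp]:
  assumes "x \<in> carrier R" "y \<in> carrier R"
  shows "x \<otimes>\<^bsub>R\<^esub> y \<in> carrier R"
proof -
  have "x \<otimes>\<^bsub>R\<^esub> y \<in> extensional (carrier G)" by (simp add: group_algebra_def)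
  moreover have "(x \<otimes>\<^bsub>R\<^esub> y) g \<in> carrier F" if "g \<in> carrier G" for g
    using assms that by (subst mult_coeff) (auto intro!: F.finsum_closed)
  ultimately show ?thesis by (auto simp: carrier_R PiE_def)
qed

lemma monomial_mult_coeff:
  assumes "c \<in> carrier F" "h \<in> carrier G" "x \<in> carrier R" "g \<in> carrier G"
  shows "(monomial c h \<otimes>\<^bsub>R\<^esub> x) g = c \<otimes>\<^bsub>F\<^esub> x (inv\<^bsub>G\<^esub> h \<otimes>\<^bsub>G\<^esub> g)"
proof -
  have "(monomial c h \<otimes>\<^bsub>R\<^esub> x) g
      = (\<Oplus>\<^bsub>F\<^esub>k\<in>carrier G. if h = k then c \<otimes>\<^bsub>F\<^esub> x (inv\<^bsub>G\<^esub> k \<otimes>\<^bsub>G\<^esub> g) else \<zero>\<^bsub>F\<^esub>)"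
    using assms by (subst mult_coeff) (auto simp: monomial_coeff intro!: F.finsum_cong')
  also have "\<dots> = c \<otimes>\<^bsub>F\<^esub> x (inv\<^bsub>G\<^esub> h \<otimes>\<^bsub>G\<^esub> g)"
    using assms fin by (intro F.finsum_singleton) auto
  finally show ?thesis .
qed

lemma mult_monomial_coeff:
  assumes "c \<in> carrier F" "h \<in> carrier G" "x \<in> carrier R" "g \<in> carrier G"
  shows "(x \<otimes>\<^bsub>R\<^esub> monomial c h) g = x (g \<otimes>\<^bsub>G\<^esub> inv\<^bsub>G\<^esub> h) \<otimes>\<^bsub>F\<^esub> c"
proof -
  have eq: "inv\<^bsub>G\<^esub> k \<otimes>\<^bsub>G\<^esub> g = h \<longleftrightarrow> g \<otimes>\<^bsub>G\<^esub> inv\<^bsub>G\<^esub> h = k" if "k \<in> carrier G" for k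
    using assms that by (metis G.inv_solve_left' G.inv_solve_right')
  have "(x \<otimes>\<^bsub>R\<^esub> monomial c h) g
      = (\<Oplus>\<^bsub>F\<^esub>k\<in>carrier G. if g \<otimes>\<^bsub>G\<^esub> inv\<^bsub>G\<^esub> h = k then x k \<otimes>\<^bsub>F\<^esub> c else \<zero>\<^bsub>F\<^esub>)"
    using assms by (subst mult_coeff) (auto simp: monomial_coeff eq intro!: F.finsum_cong')
  also have "\<dots> = x (g \<otimes>\<^bsub>G\<^esub> inv\<^bsub>G\<^esub> h) \<otimes>\<^bsub>F\<^esub> c"
    using assms fin by (intro F.finsum_singleton) auto
  finally show ?thesis .
qed

lemma finsum_translate:
  assumes "k \<in> carrier G" "\<And>h. h \<in> carrier G \<Longrightarrow> f h \<in> carrier F"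
  shows "(\<Oplus>\<^bsub>F\<^esub>h\<in>carrier G. f (k \<otimes>\<^bsub>G\<^esub> h)) = (\<Oplus>\<^bsub>F\<^esub>h\<in>carrier G. f h)"
proof -
  have "(\<lambda>h. k \<otimes>\<^bsub>G\<^esub> h) ` carrier G = carrier G"
  proof (intro equalityI subsetI)
    fix h assume "h \<in> carrier G"
    then have "h = k \<otimes>\<^bsub>G\<^esub> (inv\<^bsub>G\<^esub> k \<otimes>\<^bsub>G\<^esub> h)" "inv\<^bsub>G\<^esub> k \<otimes>\<^bsub>G\<^esub> h \<in> carrier G"
      using assms(1) by (simp_all add: G.m_assoc[symmetric])
    then show "h \<in> (\<lambda>h. k \<otimes>\<^bsub>G\<^esub> h) ` carrier G" by blast
  qed (use assms(1) in auto)
  moreover have "inj_on (\<lambda>h. k \<otimes>\<^bsub>G\<^esub> h) (carrier G)"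
    using assms(1) by (auto intro!: inj_onI)
  ultimately show ?thesis
    using F.finsum_reindex[of f "\<lambda>h. k \<otimes>\<^bsub>G\<^esub> h" "carrier G"] assms by auto
qed

text \<open>Both sides expand to one double sum: interchange the summations and substitute a
  translated index in the inner sum.\<close>

lemma mult_assoc:
  assumes x: "x \<in> carrier R" and y: "y \<in> carrier R" and z: "z \<in> carrier R"
  shows "x \<otimes>\<^bsub>R\<^esub> y \<otimes>\<^bsub>R\<^esub> z = x \<otimes>\<^bsub>R\<^esub> (y \<otimes>\<^bsub>R\<^esub> z)"
proof (rule R_eqI)
  fix g assume g: "g \<in> carrier G"
  let ?f = "\<lambda>h k. x k \<otimes>\<^bsub>F\<^esub> (y (inv\<^bsub>G\<^esub> k \<otimes>\<^bsub>G\<^esub> h) \<otimes>\<^bsub>F\<^esub> z (inv\<^bsub>G\<^esub> h \<otimes>\<^bsub>G\<^esub> g))"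
  have "(x \<otimes>\<^bsub>R\<^esub> y \<otimes>\<^bsub>R\<^esub> z) g = (\<Oplus>\<^bsub>F\<^esub>h\<in>carrier G. (x \<otimes>\<^bsub>R\<^esub> y) h \<otimes>\<^bsub>F\<^esub> z (inv\<^bsub>G\<^esub> h \<otimes>\<^bsub>G\<^esub> g))"
    using x y z g by (intro mult_coeff) auto
  also have "\<dots> = (\<Oplus>\<^bsub>F\<^esub>h\<in>carrier G. \<Oplus>\<^bsub>F\<^esub>k\<in>carrier G. ?f h k)"
  proof (intro F.finsum_cong')
    fix h assume h: "h \<in> carrier G"
    show "(x \<otimes>\<^bsub>R\<^esub> y) h \<otimes>\<^bsub>F\<^esub> z (inv\<^bsub>G\<^esub> h \<otimes>\<^bsub>G\<^esub> g) = (\<Oplus>\<^bsub>F\<^esub>k\<in>carrier G. ?f h k)"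
      using x y z g h fin
      by (subst mult_coeff, simp_all, subst F.finsum_ldistr)
        (auto simp: F.m_assoc intro!: F.finsum_cong')
  qed (use x y z g in \<open>auto intro!: F.finsum_closed\<close>)
  also have "\<dots> = (\<Oplus>\<^bsub>F\<^esub>k\<in>carrier G. \<Oplus>\<^bsub>F\<^esub>h\<in>carrier G. ?f h k)"
    using x y z g fin by (intro F.finsum_swap) auto
  also have "\<dots> = (\<Oplus>\<^bsub>F\<^esub>k\<in>carrier G. x k \<otimes>\<^bsub>F\<^esub> (y \<otimes>\<^bsub>R\<^esub> z) (inv\<^bsub>G\<^esub> k \<otimes>\<^bsub>G\<^esub> g))"
  proof (intro F.finsum_cong')
    fix k assume k: "k \<in> carrier G"
    let ?t = "\<lambda>l. y l \<otimes>\<^bsub>F\<^esub> z (inv\<^bsub>G\<^esub> l \<otimes>\<^bsub>G\<^esub> (inv\<^bsub>G\<^esub> k \<otimes>\<^bsub>G\<^esub> g))"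
    have "(y \<otimes>\<^bsub>R\<^esub> z) (inv\<^bsub>G\<^esub> k \<otimes>\<^bsub>G\<^esub> g) = (\<Oplus>\<^bsub>F\<^esub>l\<in>carrier G. ?t l)"
      using y z g k by (intro mult_coeff) auto
    \<comment> \<open>Substitution of \<open>inv k h\<close> for \<open>l\<close>, with
      \<open>k\<close> fixed; left translation permutes the group.\<close>
    also have "\<dots> = (\<Oplus>\<^bsub>F\<^esub>h\<in>carrier G. ?t (inv\<^bsub>G\<^esub> k \<otimes>\<^bsub>G\<^esub> h))"
      using y z g k by (intro finsum_translate[symmetric]) auto
    also have "\<dots> = (\<Oplus>\<^bsub>F\<^esub>h\<in>carrier G. y (inv\<^bsub>G\<^esub> k \<otimes>\<^bsub>G\<^esub> h) \<otimes>\<^bsub>F\<^esub> z (inv\<^bsub>G\<^esub> h \<otimes>\<^bsub>G\<^esub> g))"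
    proof (intro F.finsum_cong' refl)
      fix h assume h: "h \<in> carrier G"
      have "inv\<^bsub>G\<^esub> (inv\<^bsub>G\<^esub> k \<otimes>\<^bsub>G\<^esub> h) \<otimes>\<^bsub>G\<^esub> (inv\<^bsub>G\<^esub> k \<otimes>\<^bsub>G\<^esub> g) = inv\<^bsub>G\<^esub> h \<otimes>\<^bsub>G\<^esub> (k \<otimes>\<^bsub>G\<^esub> inv\<^bsub>G\<^esub> k) \<otimes>\<^bsub>G\<^esub> g"
        using g h k by (simp only: G.inv_mult_group G.inv_closed G.inv_inv G.m_assoc G.m_closed)
      then show "?t (inv\<^bsub>G\<^esub> k \<otimes>\<^bsub>G\<^esub> h) = y (inv\<^bsub>G\<^esub> k \<otimes>\<^bsub>G\<^esub> h) \<otimes>\<^bsub>F\<^esub> z (inv\<^bsub>G\<^esub> h \<otimes>\<^bsub>G\<^esub> g)"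
        using g h k by simp
    qed (use y z g k in auto)
    finally show "(\<Oplus>\<^bsub>F\<^esub>h\<in>carrier G. ?f h k) = x k \<otimes>\<^bsub>F\<^esub> (y \<otimes>\<^bsub>R\<^esub> z) (inv\<^bsub>G\<^esub> k \<otimes>\<^bsub>G\<^esub> g)"
      using x y z g k fin by (simp add: F.finsum_rdistr)
  qed (use x y z g in \<open>auto intro!: F.finsum_closed\<close>)
  also have "\<dots> = (x \<otimes>\<^bsub>R\<^esub> (y \<otimes>\<^bsub>R\<^esub> z)) g"
    using x y z g by (intro mult_coeff[symmetric]) auto
  finally show "(x \<otimes>\<^bsub>R\<^esub> y \<otimes>\<^bsub>R\<^esub> z) g = (x \<otimes>\<^bsub>R\<^esub> (y \<otimes>\<^bsub>R\<^esub> z)) g" .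
qed (use x y z in auto)

section \<open>Ring structure, group elements and scalars in the group algebra\<close>

lemma ring_R: "ring R"
proof (rule ringI)
  show "abelian_group R"
  proof (rule abelian_groupI)
    fix x assume x: "x \<in> carrier R"
    let ?y = "\<lambda>g\<in>carrier G. \<ominus>\<^bsub>F\<^esub> x g"
    have "?y \<in> carrier R" using x by (auto simp: carrier_R PiE_def)
    moreover from this have "?y \<oplus>\<^bsub>R\<^esub> x = \<zero>\<^bsub>R\<^esub>" using x by (intro R_eqI) (auto simp: F.l_neg)
    ultimately show "\<exists>y\<in>carrier R. y \<oplus>\<^bsub>R\<^esub> x = \<zero>\<^bsub>R\<^esub>" by blast
  qed (auto intro!: R_eqI simp: F.a_ac)
  show "monoid R"
  proof (rule monoidI)
    fix x assume "x \<in> carrier R"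
    then show "\<one>\<^bsub>R\<^esub> \<otimes>\<^bsub>R\<^esub> x = x" "x \<otimes>\<^bsub>R\<^esub> \<one>\<^bsub>R\<^esub> = x"
      by (auto intro!: R_eqI simp: one_monomial monomial_mult_coeff mult_monomial_coeff)
  qed (auto simp: mult_assoc)
next
  fix x y z assume xyz: "x \<in> carrier R" "y \<in> carrier R" "z \<in> carrier R"
  show "(x \<oplus>\<^bsub>R\<^esub> y) \<otimes>\<^bsub>R\<^esub> z = x \<otimes>\<^bsub>R\<^esub> z \<oplus>\<^bsub>R\<^esub> y \<otimes>\<^bsub>R\<^esub> z"
  proof (rule R_eqI)
    fix g assume g: "g \<in> carrier G"
    let ?z = "\<lambda>h. z (inv\<^bsub>G\<^esub> h \<otimes>\<^bsub>G\<^esub> g)"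
    have "((x \<oplus>\<^bsub>R\<^esub> y) \<otimes>\<^bsub>R\<^esub> z) g = (\<Oplus>\<^bsub>F\<^esub>h\<in>carrier G. (x \<oplus>\<^bsub>R\<^esub> y) h \<otimes>\<^bsub>F\<^esub> ?z h)"
      using xyz g by (intro mult_coeff R_closed)
    also have "\<dots> = (\<Oplus>\<^bsub>F\<^esub>h\<in>carrier G. x h \<otimes>\<^bsub>F\<^esub> ?z h \<oplus>\<^bsub>F\<^esub> y h \<otimes>\<^bsub>F\<^esub> ?z h)"
      by (rule F.finsum_cong') (use xyz g in \<open>auto simp: F.l_distr\<close>)
    also have "\<dots> = (\<Oplus>\<^bsub>F\<^esub>h\<in>carrier G. x h \<otimes>\<^bsub>F\<^esub> ?z h) \<oplus>\<^bsub>F\<^esub> (\<Oplus>\<^bsub>F\<^esub>h\<in>carrier G. y h \<otimes>\<^bsub>F\<^esub> ?z h)"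
      by (rule F.finsum_addf) (use xyz g in auto)
    finally show "((x \<oplus>\<^bsub>R\<^esub> y) \<otimes>\<^bsub>R\<^esub> z) g = (x \<otimes>\<^bsub>R\<^esub> z \<oplus>\<^bsub>R\<^esub> y \<otimes>\<^bsub>R\<^esub> z) g"
      using xyz g by (simp only: mult_coeff add_coeff)
  qed (use xyz in auto)
  show "z \<otimes>\<^bsub>R\<^esub> (x \<oplus>\<^bsub>R\<^esub> y) = z \<otimes>\<^bsub>R\<^esub> x \<oplus>\<^bsub>R\<^esub> z \<otimes>\<^bsub>R\<^esub> y"
  proof (rule R_eqI)
    fix g assume g: "g \<in> carrier G"
    let ?x = "\<lambda>h. x (inv\<^bsub>G\<^esub> h \<otimes>\<^bsub>G\<^esub> g)" and ?y = "\<lambda>h. y (inv\<^bsub>G\<^esub> h \<otimes>\<^bsub>G\<^esub> g)"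
    have "(z \<otimes>\<^bsub>R\<^esub> (x \<oplus>\<^bsub>R\<^esub> y)) g = (\<Oplus>\<^bsub>F\<^esub>h\<in>carrier G. z h \<otimes>\<^bsub>F\<^esub> (x \<oplus>\<^bsub>R\<^esub> y) (inv\<^bsub>G\<^esub> h \<otimes>\<^bsub>G\<^esub> g))"
      using xyz g by (intro mult_coeff R_closed)
    also have "\<dots> = (\<Oplus>\<^bsub>F\<^esub>h\<in>carrier G. z h \<otimes>\<^bsub>F\<^esub> ?x h \<oplus>\<^bsub>F\<^esub> z h \<otimes>\<^bsub>F\<^esub> ?y h)"
      by (rule F.finsum_cong') (use xyz g in \<open>auto simp: F.r_distr\<close>)
    also have "\<dots> = (\<Oplus>\<^bsub>F\<^esub>h\<in>carrier G. z h \<otimes>\<^bsub>F\<^esub> ?x h) \<oplus>\<^bsub>F\<^esub> (\<Oplus>\<^bsub>F\<^esub>h\<in>carrier G. z h \<otimes>\<^bsub>F\<^esub> ?y h)"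
      by (rule F.finsum_addf) (use xyz g in auto)
    finally show "(z \<otimes>\<^bsub>R\<^esub> (x \<oplus>\<^bsub>R\<^esub> y)) g = (z \<otimes>\<^bsub>R\<^esub> x \<oplus>\<^bsub>R\<^esub> z \<otimes>\<^bsub>R\<^esub> y) g"
      using xyz g by (simp only: mult_coeff add_coeff)
  qed (use xyz in auto)
qed

sublocale R: ring R by (rule ring_R)

lemma monomial_mult:
  assumes "c \<in> carrier F" "d \<in> carrier F" "g \<in> carrier G" "h \<in> carrier G"
  shows "monomial c g \<otimes>\<^bsub>R\<^esub> monomial d h = monomial (c \<otimes>\<^bsub>F\<^esub> d) (g \<otimes>\<^bsub>G\<^esub> h)"
proof -
  have "inv\<^bsub>G\<^esub> g \<otimes>\<^bsub>G\<^esub> k = h \<longleftrightarrow> k = g \<otimes>\<^bsub>G\<^esub> h" if "k \<in> carrier G" for k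
    using assms that by (metis G.inv_solve_left')
  then show ?thesis
    using assms by (intro R_eqI) (auto simp: monomial_mult_coeff, auto simp: monomial_coeff)
qed

abbreviation "scalar c \<equiv> monomial c \<one>\<^bsub>G\<^esub>"
abbreviation "emb \<equiv> group_algebra_embed F G"

lemma emb_closed [simp]: "emb g \<in> carrier R"
  by (simp add: embed_monomial)

lemma emb_one: "emb \<one>\<^bsub>G\<^esub> = \<one>\<^bsub>R\<^esub>"
  by (simp add: embed_monomial one_monomial)

lemma emb_mult: "g \<in> carrier G \<Longrightarrow> h \<in> carrier G \<Longrightarrow> emb (g \<otimes>\<^bsub>G\<^esub> h) = emb g \<otimes>\<^bsub>R\<^esub> emb h"
  by (simp add: embed_monomial monomial_mult)

lemma emb_inj: "inj_on emb (carrier G)"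
proof (rule inj_onI)
  fix g h assume gh: "g \<in> carrier G" "h \<in> carrier G" and "emb g = emb h"
  then have "emb g g = emb h g" by simp
  then show "g = h" using gh by (auto simp: group_algebra_embed_def split: if_splits)
qed

lemma scalar_hom: "ring_hom_ring F R scalar"
proof (rule ring_hom_ringI2[OF F.ring_axioms ring_R])
  show "scalar \<in> ring_hom F R"
  proof (rule ring_hom_memI)
    fix c d assume cd: "c \<in> carrier F" "d \<in> carrier F"
    show "scalar (c \<otimes>\<^bsub>F\<^esub> d) = scalar c \<otimes>\<^bsub>R\<^esub> scalar d" using cd by (simp add: monomial_mult)
    show "scalar (c \<oplus>\<^bsub>F\<^esub> d) = scalar c \<oplus>\<^bsub>R\<^esub> scalar d"
      using cd by (intro R_eqI) (auto simp: monomial_coeff)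
  qed (auto simp: one_monomial)
qed

lemma scalar_central:
  "c \<in> carrier F \<Longrightarrow> x \<in> carrier R \<Longrightarrow> scalar c \<otimes>\<^bsub>R\<^esub> x = x \<otimes>\<^bsub>R\<^esub> scalar c"
  by (intro R_eqI) (auto simp: monomial_mult_coeff mult_monomial_coeff F.m_comm)

text \<open>An induction principle: \<open>x\<close> is assembled from its terms \<open>c g\<close>
  by enlarging the set of retained coefficients one group element at a time.\<close>

lemma spanned_by_group:
  assumes zero: "\<zero>\<^bsub>R\<^esub> \<in> M" and add: "\<And>x y. x \<in> M \<Longrightarrow> y \<in> M \<Longrightarrow> x \<oplus>\<^bsub>R\<^esub> y \<in> M"
    and mon: "\<And>c g. c \<in> carrier F \<Longrightarrow> g \<in> carrier G \<Longrightarrow> scalar c \<otimes>\<^bsub>R\<^esub> emb g \<in> M"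
    and x: "x \<in> carrier R"
  shows "x \<in> M"
proof -
  \<comment> \<open>The truncation of \<open>x\<close> to coefficients in \<open>S\<close>; the
    induction runs over \<open>S\<close>.\<close>
  let ?r = "\<lambda>S. \<lambda>g\<in>carrier G. if g \<in> S then x g else \<zero>\<^bsub>F\<^esub>"
  have r: "?r S \<in> carrier R" for S using x by (auto simp: carrier_R)
  have "finite S \<Longrightarrow> S \<subseteq> carrier G \<Longrightarrow> ?r S \<in> M" for S
  proof (induction S rule: finite_induct)
    case empty
    have "?r {} = \<zero>\<^bsub>R\<^esub>" using r[of "{}"] by (intro R_eqI) auto
    then show ?case using zero by simp
  next
    case (insert h S)
    have xh: "x h \<in> carrier F" using insert x by simp
    have "scalar (x h) \<otimes>\<^bsub>R\<^esub> emb h = monomial (x h) h"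
      using xh insert by (simp add: embed_monomial monomial_mult)
    then have eq: "?r (insert h S) = scalar (x h) \<otimes>\<^bsub>R\<^esub> emb h \<oplus>\<^bsub>R\<^esub> ?r S"
      using r[of S] r[of "insert h S"] xh x insert.hyps(2) by (intro R_eqI) (auto simp: monomial_coeff)
    have "scalar (x h) \<otimes>\<^bsub>R\<^esub> emb h \<in> M" "?r S \<in> M"
      using mon xh insert.IH insert.prems by blast+
    then show ?case unfolding eq by (rule add)
  qed
  from this[OF fin] have "?r (carrier G) \<in> M" by simp
  moreover have "?r (carrier G) = x" using x r by (intro R_eqI) auto
  ultimately show ?thesis by simp
qed

section \<open>The augmentation as a ring homomorphism\<close>

lemma augmentation_eq:
  assumes x: "x \<in> carrier R"
  shows "augmentation F G x = (\<Oplus>\<^bsub>F\<^esub>g\<in>carrier G. x g)"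
  unfolding augmentation_def using x fin
  by (intro F.add.finprod_mono_neutral_cong_left) (auto simp: group_algebra_support_def)

lemma augmentation_monomial:
  assumes "c \<in> carrier F" "g \<in> carrier G"
  shows "augmentation F G (monomial c g) = c"
proof -
  have "augmentation F G (monomial c g) = (\<Oplus>\<^bsub>F\<^esub>k\<in>carrier G. if g = k then c else \<zero>\<^bsub>F\<^esub>)"
    using assms by (subst augmentation_eq) (auto simp: monomial_coeff intro!: F.finsum_cong')
  also have "\<dots> = c" using assms fin by (intro F.finsum_singleton) auto
  finally show ?thesis .
qed

lemma augmentation_closed [simp]: "x \<in> carrier R \<Longrightarrow> augmentation F G x \<in> carrier F"
  by (auto simp: augmentation_eq intro!: F.finsum_closed)

lemma augmentation_add:
  assumes "x \<in> carrier R" "y \<in> carrier R"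
  shows "augmentation F G (x \<oplus>\<^bsub>R\<^esub> y) = augmentation F G x \<oplus>\<^bsub>F\<^esub> augmentation F G y"
proof -
  have "augmentation F G (x \<oplus>\<^bsub>R\<^esub> y) = (\<Oplus>\<^bsub>F\<^esub>g\<in>carrier G. (x \<oplus>\<^bsub>R\<^esub> y) g)"
    using assms by (intro augmentation_eq R_closed)
  also have "\<dots> = (\<Oplus>\<^bsub>F\<^esub>g\<in>carrier G. x g \<oplus>\<^bsub>F\<^esub> y g)"
    by (rule F.finsum_cong') (use assms in auto)
  also have "\<dots> = (\<Oplus>\<^bsub>F\<^esub>g\<in>carrier G. x g) \<oplus>\<^bsub>F\<^esub> (\<Oplus>\<^bsub>F\<^esub>g\<in>carrier G. y g)"
    by (rule F.finsum_addf) (use assms in auto)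
  also have "\<dots> = augmentation F G x \<oplus>\<^bsub>F\<^esub> augmentation F G y"
    using assms by (simp only: augmentation_eq)
  finally show ?thesis .
qed

lemma augmentation_mult:
  assumes x: "x \<in> carrier R" and y: "y \<in> carrier R"
  shows "augmentation F G (x \<otimes>\<^bsub>R\<^esub> y) = augmentation F G x \<otimes>\<^bsub>F\<^esub> augmentation F G y"
proof -
  \<comment> \<open>The sum \<open>t\<close> of all group elements satisfies \<open>x t = aug(x) t\<close>, which reduces the claim to associativity.\<close>
  define t where "t = (\<lambda>g\<in>carrier G. \<one>\<^bsub>F\<^esub>)"
  have t: "t \<in> carrier R" by (auto simp: t_def carrier_R)
  have coeff: "(z \<otimes>\<^bsub>R\<^esub> t) g = augmentation F G z" if "z \<in> carrier R" "g \<in> carrier G" for z g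
  proof -
    have "(z \<otimes>\<^bsub>R\<^esub> t) g = (\<Oplus>\<^bsub>F\<^esub>h\<in>carrier G. z h)"
      using that t by (subst mult_coeff) (auto simp: t_def intro!: F.finsum_cong')
    then show ?thesis using that by (simp add: augmentation_eq)
  qed
  have "augmentation F G (x \<otimes>\<^bsub>R\<^esub> y) = (x \<otimes>\<^bsub>R\<^esub> y \<otimes>\<^bsub>R\<^esub> t) \<one>\<^bsub>G\<^esub>"
    using x y by (intro coeff[symmetric]) auto
  also have "\<dots> = (x \<otimes>\<^bsub>R\<^esub> (y \<otimes>\<^bsub>R\<^esub> t)) \<one>\<^bsub>G\<^esub>"
    using x y t by (simp only: R.m_assoc)
  also have "\<dots> = (\<Oplus>\<^bsub>F\<^esub>h\<in>carrier G. x h \<otimes>\<^bsub>F\<^esub> (y \<otimes>\<^bsub>R\<^esub> t) (inv\<^bsub>G\<^esub> h \<otimes>\<^bsub>G\<^esub> \<one>\<^bsub>G\<^esub>))"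
    using x y t by (intro mult_coeff) auto
  also have "\<dots> = (\<Oplus>\<^bsub>F\<^esub>h\<in>carrier G. x h \<otimes>\<^bsub>F\<^esub> augmentation F G y)"
    by (rule F.finsum_cong') (use x y in \<open>auto simp: coeff\<close>)
  also have "\<dots> = (\<Oplus>\<^bsub>F\<^esub>h\<in>carrier G. x h) \<otimes>\<^bsub>F\<^esub> augmentation F G y"
    using x y fin by (intro F.finsum_ldistr[symmetric]) auto
  also have "\<dots> = augmentation F G x \<otimes>\<^bsub>F\<^esub> augmentation F G y"
    using x by (simp only: augmentation_eq)
  finally show ?thesis .
qed

lemma augmentation_hom: "ring_hom_ring R F (augmentation F G)"
proof (rule ring_hom_ringI2[OF ring_R F.ring_axioms])
  show "augmentation F G \<in> ring_hom R F"
    by (rule ring_hom_memI)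
      (simp_all add: augmentation_add augmentation_mult one_monomial augmentation_monomial)
qed

end

section \<open>Idempotents from roots of unity\<close>

text \<open>For a cyclic summand the shift only moves the term at 0 to the end, where it reappears
  as the term at \<open>q\<close>.\<close>

lemma (in abelian_monoid) finsum_lessThan_shift:
  assumes f: "\<And>j. j \<le> q \<Longrightarrow> f j \<in> carrier G" and per: "f q = f 0"
  shows "(\<Oplus>j\<in>{..<q}. f (Suc j)) = (\<Oplus>j\<in>{..<q::nat}. f j)"
proof (cases q)
  case (Suc m)
  have "(\<Oplus>j\<in>{..<q}. f (Suc j)) = f q \<oplus> (\<Oplus>j\<in>{..<m}. f (Suc j))"
    using f by (simp add: Suc lessThan_Suc Pi_def)
  also have "(\<Oplus>j\<in>{..<m}. f (Suc j)) = (\<Oplus>j\<in>Suc ` {..<m}. f j)"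
    using f by (subst finsum_reindex) (auto simp: Suc)
  also have "f q \<oplus> \<dots> = (\<Oplus>j\<in>insert 0 (Suc ` {..<m}). f j)"
    using f by (subst finsum_insert) (auto simp: Suc per[symmetric])
  finally show ?thesis by (simp only: Suc lessThan_Suc_eq_insert_0)
qed simp

text \<open>An \<open>F\<close>-algebra \<open>R\<close> with structure map \<open>sc\<close>, an
  element \<open>b\<close> with \<open>q\<close>-th power one, a primitive \<open>q\<close>-th root
  of unity \<open>z\<close> with inverse \<open>zi\<close>, and \<open>k\<close>, the inverse of
  \<open>q\<close> in \<open>F\<close>.\<close>

locale cyclic_idempotents = F: field F + R: ring R + sc: ring_hom_ring F R sc
  for F :: "('f, 'm) ring_scheme" and R :: "('r, 'n) ring_scheme" and sc +
  fixes q :: nat and z zi k b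
  assumes central: "\<And>c x. c \<in> carrier F \<Longrightarrow> x \<in> carrier R \<Longrightarrow> sc c \<otimes>\<^bsub>R\<^esub> x = x \<otimes>\<^bsub>R\<^esub> sc c"
    and z [simp]: "z \<in> carrier F" and zi [simp]: "zi \<in> carrier F" and k [simp]: "k \<in> carrier F"
    and z_zi: "z \<otimes>\<^bsub>F\<^esub> zi = \<one>\<^bsub>F\<^esub>" and z_pow: "z [^]\<^bsub>F\<^esub> q = \<one>\<^bsub>F\<^esub>"
    and primitive: "\<And>i. 0 < i \<Longrightarrow> i < q \<Longrightarrow> z [^]\<^bsub>F\<^esub> i \<noteq> \<one>\<^bsub>F\<^esub>"
    and k_q: "k \<otimes>\<^bsub>F\<^esub> ([q] \<cdot>\<^bsub>F\<^esub> \<one>\<^bsub>F\<^esub>) = \<one>\<^bsub>F\<^esub>"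
    and b [simp]: "b \<in> carrier R" and b_pow: "b [^]\<^bsub>R\<^esub> q = \<one>\<^bsub>R\<^esub>"
begin

text \<open>The idempotent of the group algebra of a cyclic group that belongs to the character
  sending \<open>b\<close> to the \<open>i\<close>-th power of \<open>z\<close>.\<close>

definition idem :: "nat \<Rightarrow> 'r" where
  "idem i = sc k \<otimes>\<^bsub>R\<^esub> (\<Oplus>\<^bsub>R\<^esub>j\<in>{..<q}. sc (zi [^]\<^bsub>F\<^esub> (i * j)) \<otimes>\<^bsub>R\<^esub> b [^]\<^bsub>R\<^esub> j)"

lemma idem_closed [simp]: "idem i \<in> carrier R"
  by (auto simp: idem_def intro!: R.finsum_closed)

lemma scalar_left:
  "c \<in> carrier F \<Longrightarrow> x \<in> carrier R \<Longrightarrow> y \<in> carrier R \<Longrightarrow>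
    x \<otimes>\<^bsub>R\<^esub> (sc c \<otimes>\<^bsub>R\<^esub> y) = sc c \<otimes>\<^bsub>R\<^esub> (x \<otimes>\<^bsub>R\<^esub> y)"
  by (metis R.m_assoc central sc.hom_closed)

lemma scalar_mult_assoc:
  "c \<in> carrier F \<Longrightarrow> d \<in> carrier F \<Longrightarrow> y \<in> carrier R \<Longrightarrow>
    sc c \<otimes>\<^bsub>R\<^esub> (sc d \<otimes>\<^bsub>R\<^esub> y) = sc (c \<otimes>\<^bsub>F\<^esub> d) \<otimes>\<^bsub>R\<^esub> y"
  by (simp add: R.m_assoc)

text \<open>The nonzero scalar \<open>c - d\<close> is invertible and kills
  \<open>x\<close>.\<close>

lemma scalar_cancel:
  assumes "c \<in> carrier F" "d \<in> carrier F" "c \<noteq> d" "x \<in> carrier R"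
    and eq: "sc c \<otimes>\<^bsub>R\<^esub> x = sc d \<otimes>\<^bsub>R\<^esub> x"
  shows "x = \<zero>\<^bsub>R\<^esub>"
proof -
  let ?t = "c \<ominus>\<^bsub>F\<^esub> d"
  have t: "?t \<in> Units F"
    using assms by (simp add: F.field_Units)
  have "sc ?t \<otimes>\<^bsub>R\<^esub> x = \<zero>\<^bsub>R\<^esub>"
    using assms by (simp add: F.minus_eq R.l_distr R.l_minus R.r_neg)
  then have "sc (inv\<^bsub>F\<^esub> ?t) \<otimes>\<^bsub>R\<^esub> (sc ?t \<otimes>\<^bsub>R\<^esub> x) = \<zero>\<^bsub>R\<^esub>"
    using t by (simp del: sc.hom_mult)
  then show ?thesis using t assms by (simp only: scalar_mult_assoc F.Units_inv_closed F.Units_closed F.Units_l_inv sc.hom_one R.l_one)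
qed

lemma zi_pow: "zi [^]\<^bsub>F\<^esub> q = \<one>\<^bsub>F\<^esub>"
proof -
  have "z [^]\<^bsub>F\<^esub> q \<otimes>\<^bsub>F\<^esub> zi [^]\<^bsub>F\<^esub> q = \<one>\<^bsub>F\<^esub>"
    by (simp add: F.nat_pow_distrib[symmetric] z_zi)
  then show ?thesis by (simp add: z_pow)
qed

lemma z_pow_zi_pow: "z [^]\<^bsub>F\<^esub> (i::nat) \<otimes>\<^bsub>F\<^esub> zi [^]\<^bsub>F\<^esub> i = \<one>\<^bsub>F\<^esub>"
  by (simp add: F.nat_pow_distrib[symmetric] z_zi)

lemma z_pow_inj:
  assumes "i < j" "j < q"
  shows "z [^]\<^bsub>F\<^esub> i \<noteq> z [^]\<^bsub>F\<^esub> j"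
proof
  assume "z [^]\<^bsub>F\<^esub> i = z [^]\<^bsub>F\<^esub> j"
  then have "z [^]\<^bsub>F\<^esub> j \<otimes>\<^bsub>F\<^esub> zi [^]\<^bsub>F\<^esub> i = \<one>\<^bsub>F\<^esub>" by (metis z_pow_zi_pow)
  moreover have "z [^]\<^bsub>F\<^esub> j = z [^]\<^bsub>F\<^esub> (j - i) \<otimes>\<^bsub>F\<^esub> z [^]\<^bsub>F\<^esub> i"
    using assms by (simp add: F.nat_pow_mult)
  ultimately have "z [^]\<^bsub>F\<^esub> (j - i) = \<one>\<^bsub>F\<^esub>"
    using z_pow_zi_pow[of i] by (simp add: F.m_assoc)
  then show False using primitive[of "j - i"] assms by simp
qed

text \<open>Each \<open>idem i\<close> is a polynomial in \<open>b\<close> with central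
  coefficients.\<close>

lemma commutes_idem:
  assumes x: "x \<in> carrier R" and xb: "x \<otimes>\<^bsub>R\<^esub> b = b \<otimes>\<^bsub>R\<^esub> x"
  shows "x \<otimes>\<^bsub>R\<^esub> idem i = idem i \<otimes>\<^bsub>R\<^esub> x"
proof -
  let ?t = "\<lambda>j. sc (zi [^]\<^bsub>F\<^esub> (i * j)) \<otimes>\<^bsub>R\<^esub> b [^]\<^bsub>R\<^esub> j"
  have t: "x \<otimes>\<^bsub>R\<^esub> ?t j = ?t j \<otimes>\<^bsub>R\<^esub> x" for j
    using R.group_commutes_pow[of b x j] x xb by (simp add: scalar_left R.m_assoc)
  have "x \<otimes>\<^bsub>R\<^esub> idem i = sc k \<otimes>\<^bsub>R\<^esub> (x \<otimes>\<^bsub>R\<^esub> (\<Oplus>\<^bsub>R\<^esub>j\<in>{..<q}. ?t j))"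
    unfolding idem_def using x by (intro scalar_left) (auto intro!: R.finsum_closed)
  also have "x \<otimes>\<^bsub>R\<^esub> (\<Oplus>\<^bsub>R\<^esub>j\<in>{..<q}. ?t j) = (\<Oplus>\<^bsub>R\<^esub>j\<in>{..<q}. x \<otimes>\<^bsub>R\<^esub> ?t j)"
    by (rule R.finsum_rdistr) (use x in auto)
  also have "\<dots> = (\<Oplus>\<^bsub>R\<^esub>j\<in>{..<q}. ?t j \<otimes>\<^bsub>R\<^esub> x)" by (simp only: t)
  also have "\<dots> = (\<Oplus>\<^bsub>R\<^esub>j\<in>{..<q}. ?t j) \<otimes>\<^bsub>R\<^esub> x"
    by (rule R.finsum_ldistr[symmetric]) (use x in auto)
  also have "sc k \<otimes>\<^bsub>R\<^esub> \<dots> = idem i \<otimes>\<^bsub>R\<^esub> x"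
    unfolding idem_def using x by (subst R.m_assoc) (auto intro!: R.finsum_closed)
  finally show ?thesis .
qed

text \<open>Multiplication by \<open>b\<close> shifts the cyclic sum by one place, at the cost of
  the factor \<open>z\<close> to the power \<open>i\<close>; so \<open>idem i\<close> is an
  eigenvector of \<open>b\<close>.\<close>

lemma b_idem: "b \<otimes>\<^bsub>R\<^esub> idem i = sc (z [^]\<^bsub>F\<^esub> i) \<otimes>\<^bsub>R\<^esub> idem i"
proof -
  let ?t = "\<lambda>j. sc (zi [^]\<^bsub>F\<^esub> (i * j)) \<otimes>\<^bsub>R\<^esub> b [^]\<^bsub>R\<^esub> j"
  define f where "f j = sc (z [^]\<^bsub>F\<^esub> i) \<otimes>\<^bsub>R\<^esub> ?t j" for j
  have f: "f j \<in> carrier R" for j by (simp add: f_def)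
  have bt: "b \<otimes>\<^bsub>R\<^esub> ?t j = f (Suc j)" for j
  proof -
    have "f (Suc j) = sc (z [^]\<^bsub>F\<^esub> i \<otimes>\<^bsub>F\<^esub> (zi [^]\<^bsub>F\<^esub> i \<otimes>\<^bsub>F\<^esub> zi [^]\<^bsub>F\<^esub> (i * j))) \<otimes>\<^bsub>R\<^esub> b [^]\<^bsub>R\<^esub> Suc j"
      unfolding f_def by (subst scalar_mult_assoc) (auto simp: F.nat_pow_mult)
    also have "z [^]\<^bsub>F\<^esub> i \<otimes>\<^bsub>F\<^esub> (zi [^]\<^bsub>F\<^esub> i \<otimes>\<^bsub>F\<^esub> zi [^]\<^bsub>F\<^esub> (i * j)) = zi [^]\<^bsub>F\<^esub> (i * j)"
      by (simp add: F.m_assoc[symmetric] z_pow_zi_pow del: F.nat_pow_mult)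
    also have "b [^]\<^bsub>R\<^esub> Suc j = b \<otimes>\<^bsub>R\<^esub> b [^]\<^bsub>R\<^esub> j" by (simp only: R.nat_pow_Suc2 b)
    finally show ?thesis by (simp add: scalar_left)
  qed
  have per: "f q = f 0"
  proof -
    have "zi [^]\<^bsub>F\<^esub> (i * q) = \<one>\<^bsub>F\<^esub>"
      by (simp add: F.nat_pow_pow[symmetric] mult.commute[of i] zi_pow)
    then show ?thesis by (simp add: f_def b_pow)
  qed
  have "b \<otimes>\<^bsub>R\<^esub> idem i = sc k \<otimes>\<^bsub>R\<^esub> (b \<otimes>\<^bsub>R\<^esub> (\<Oplus>\<^bsub>R\<^esub>j\<in>{..<q}. ?t j))"
    unfolding idem_def by (intro scalar_left) (auto intro!: R.finsum_closed)
  also have "b \<otimes>\<^bsub>R\<^esub> (\<Oplus>\<^bsub>R\<^esub>j\<in>{..<q}. ?t j) = (\<Oplus>\<^bsub>R\<^esub>j\<in>{..<q}. b \<otimes>\<^bsub>R\<^esub> ?t j)"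
    by (rule R.finsum_rdistr) auto
  also have "\<dots> = (\<Oplus>\<^bsub>R\<^esub>j\<in>{..<q}. f (Suc j))" by (simp only: bt)
  also have "\<dots> = (\<Oplus>\<^bsub>R\<^esub>j\<in>{..<q}. f j)" by (rule R.finsum_lessThan_shift[OF f per])
  also have "\<dots> = sc (z [^]\<^bsub>F\<^esub> i) \<otimes>\<^bsub>R\<^esub> (\<Oplus>\<^bsub>R\<^esub>j\<in>{..<q}. ?t j)"
    unfolding f_def by (rule R.finsum_rdistr[symmetric]) auto
  also have "sc k \<otimes>\<^bsub>R\<^esub> \<dots> = sc (z [^]\<^bsub>F\<^esub> i) \<otimes>\<^bsub>R\<^esub> idem i"
    unfolding idem_def by (intro scalar_left) (auto intro!: R.finsum_closed)
  finally show ?thesis .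
qed

lemma idem_b: "idem i \<otimes>\<^bsub>R\<^esub> b = sc (z [^]\<^bsub>F\<^esub> i) \<otimes>\<^bsub>R\<^esub> idem i"
  using commutes_idem[of b i] b_idem[of i] by simp

lemma b_pow_idem: "b [^]\<^bsub>R\<^esub> j \<otimes>\<^bsub>R\<^esub> idem i = sc (z [^]\<^bsub>F\<^esub> (i * j)) \<otimes>\<^bsub>R\<^esub> idem i"
proof (induction j)
  case (Suc j)
  have "b [^]\<^bsub>R\<^esub> Suc j \<otimes>\<^bsub>R\<^esub> idem i = sc (z [^]\<^bsub>F\<^esub> i) \<otimes>\<^bsub>R\<^esub> (b [^]\<^bsub>R\<^esub> j \<otimes>\<^bsub>R\<^esub> idem i)"
    by (simp add: R.m_assoc b_idem scalar_left)
  also have "\<dots> = sc (z [^]\<^bsub>F\<^esub> (i * Suc j)) \<otimes>\<^bsub>R\<^esub> idem i"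
    unfolding Suc by (subst scalar_mult_assoc) (auto simp: F.nat_pow_mult)
  finally show ?case .
qed simp

lemma scalar_q_k:
  assumes "x \<in> carrier R"
  shows "sc k \<otimes>\<^bsub>R\<^esub> ([q] \<cdot>\<^bsub>R\<^esub> x) = x"
proof -
  have hom: "sc ([m] \<cdot>\<^bsub>F\<^esub> \<one>\<^bsub>F\<^esub>) = [m] \<cdot>\<^bsub>R\<^esub> \<one>\<^bsub>R\<^esub>" for m :: nat
    by (induction m) auto
  have "[q] \<cdot>\<^bsub>R\<^esub> x = sc ([q] \<cdot>\<^bsub>F\<^esub> \<one>\<^bsub>F\<^esub>) \<otimes>\<^bsub>R\<^esub> x"
    using assms by (simp add: hom R.add_pow_ldistr)
  then show ?thesis using assms by (simp only: scalar_mult_assoc k F.add.nat_pow_closed F.one_closed k_q sc.hom_one R.l_one)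
qed

text \<open>Every one of the \<open>q\<close> summands of the left factor acts on
  \<open>idem i\<close> as the identity, because the two powers of the root cancel; the total
  \<open>q\<close> is cancelled by \<open>k\<close>.\<close>

lemma idem_idem: "idem i \<otimes>\<^bsub>R\<^esub> idem i = idem i"
proof -
  let ?t = "\<lambda>j. sc (zi [^]\<^bsub>F\<^esub> (i * j)) \<otimes>\<^bsub>R\<^esub> b [^]\<^bsub>R\<^esub> j"
  have t: "?t j \<otimes>\<^bsub>R\<^esub> idem i = idem i" for j
  proof -
    have "?t j \<otimes>\<^bsub>R\<^esub> idem i = sc (zi [^]\<^bsub>F\<^esub> (i * j) \<otimes>\<^bsub>F\<^esub> z [^]\<^bsub>F\<^esub> (i * j)) \<otimes>\<^bsub>R\<^esub> idem i"
      by (simp add: R.m_assoc b_pow_idem)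
    then show ?thesis using z_pow_zi_pow[of "i * j"] by (simp add: F.m_comm del: sc.hom_mult)
  qed
  have "idem i \<otimes>\<^bsub>R\<^esub> idem i = sc k \<otimes>\<^bsub>R\<^esub> ((\<Oplus>\<^bsub>R\<^esub>j\<in>{..<q}. ?t j) \<otimes>\<^bsub>R\<^esub> idem i)"
    by (subst idem_def) (rule R.m_assoc, auto intro!: R.finsum_closed)
  also have "(\<Oplus>\<^bsub>R\<^esub>j\<in>{..<q}. ?t j) \<otimes>\<^bsub>R\<^esub> idem i = (\<Oplus>\<^bsub>R\<^esub>j\<in>{..<q}. ?t j \<otimes>\<^bsub>R\<^esub> idem i)"
    by (rule R.finsum_ldistr) auto
  also have "\<dots> = [q] \<cdot>\<^bsub>R\<^esub> idem i" by (simp add: t R.add.finprod_const)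
  finally show ?thesis by (simp add: scalar_q_k)
qed

text \<open>Inserting \<open>b\<close> between the factors and evaluating it to the left or to the
  right gives two different eigenvalues on the same product.\<close>

lemma idem_orthogonal:
  assumes "i < q" "j < q" "i \<noteq> j"
  shows "idem i \<otimes>\<^bsub>R\<^esub> idem j = \<zero>\<^bsub>R\<^esub>"
proof (rule scalar_cancel)
  show "z [^]\<^bsub>F\<^esub> i \<noteq> z [^]\<^bsub>F\<^esub> j" using z_pow_inj[of i j] z_pow_inj[of j i] assms by (cases "i < j") auto
  have "sc (z [^]\<^bsub>F\<^esub> i) \<otimes>\<^bsub>R\<^esub> (idem i \<otimes>\<^bsub>R\<^esub> idem j) = idem i \<otimes>\<^bsub>R\<^esub> b \<otimes>\<^bsub>R\<^esub> idem j"
    by (simp add: idem_b R.m_assoc)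
  also have "\<dots> = sc (z [^]\<^bsub>F\<^esub> j) \<otimes>\<^bsub>R\<^esub> (idem i \<otimes>\<^bsub>R\<^esub> idem j)"
    by (simp add: R.m_assoc b_idem scalar_left)
  finally show "sc (z [^]\<^bsub>F\<^esub> i) \<otimes>\<^bsub>R\<^esub> (idem i \<otimes>\<^bsub>R\<^esub> idem j) = sc (z [^]\<^bsub>F\<^esub> j) \<otimes>\<^bsub>R\<^esub> (idem i \<otimes>\<^bsub>R\<^esub> idem j)" .
qed auto

text \<open>Multiplication by the \<open>j\<close>-th power of \<open>zi\<close>, which differs from
  one, permutes the summands and so fixes the sum.\<close>

lemma sum_powers_root:
  assumes j: "0 < j" "j < q"
  shows "(\<Oplus>\<^bsub>F\<^esub>i\<in>{..<q}. zi [^]\<^bsub>F\<^esub> (i * j)) = \<zero>\<^bsub>F\<^esub>"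
proof -
  let ?t = "zi [^]\<^bsub>F\<^esub> j" and ?S = "\<Oplus>\<^bsub>F\<^esub>i\<in>{..<q}. zi [^]\<^bsub>F\<^esub> (i * j)"
  have S: "?S \<in> carrier F" by (auto intro!: F.finsum_closed)
  have "?t \<otimes>\<^bsub>F\<^esub> ?S = (\<Oplus>\<^bsub>F\<^esub>i\<in>{..<q}. ?t \<otimes>\<^bsub>F\<^esub> zi [^]\<^bsub>F\<^esub> (i * j))"
    by (rule F.finsum_rdistr) auto
  also have "\<dots> = (\<Oplus>\<^bsub>F\<^esub>i\<in>{..<q}. zi [^]\<^bsub>F\<^esub> (Suc i * j))"
    by (simp add: F.nat_pow_mult)
  also have "\<dots> = ?S"
    by (rule F.finsum_lessThan_shift) (auto simp: F.nat_pow_pow[symmetric] zi_pow)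
  finally have "?t \<otimes>\<^bsub>F\<^esub> ?S = \<one>\<^bsub>F\<^esub> \<otimes>\<^bsub>F\<^esub> ?S" using S by simp
  moreover have "?t \<noteq> \<one>\<^bsub>F\<^esub>" using z_pow_zi_pow[of j] primitive[OF j] by auto
  ultimately show ?thesis using S by (metis F.m_rcancel F.nat_pow_closed F.one_closed zi)
qed

text \<open>After interchanging the sums, the coefficient of each power of \<open>b\<close> is a sum
  of powers of a root of unity; only exponent 0 survives, with coefficient \<open>q\<close>.\<close>

lemma sum_idem: "(\<Oplus>\<^bsub>R\<^esub>i\<in>{..<q}. idem i) = \<one>\<^bsub>R\<^esub>"
proof -
  let ?t = "\<lambda>i j. sc (zi [^]\<^bsub>F\<^esub> (i * j)) \<otimes>\<^bsub>R\<^esub> b [^]\<^bsub>R\<^esub> j"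
  have q0: "0 < q" using k_q by (intro gr0I) (auto simp: F.zero_not_one)
  have hom: "finite I \<Longrightarrow> f \<in> I \<rightarrow> carrier F \<Longrightarrow> (\<Oplus>\<^bsub>R\<^esub>i\<in>I. sc (f i)) = sc (\<Oplus>\<^bsub>F\<^esub>i\<in>I. f i)" for f and I :: "nat set"
    by (induction I rule: finite_induct) (auto simp: Pi_def F.finsum_closed)
  have col: "(\<Oplus>\<^bsub>R\<^esub>i\<in>{..<q}. ?t i j) = (if 0 = j then [q] \<cdot>\<^bsub>R\<^esub> \<one>\<^bsub>R\<^esub> else \<zero>\<^bsub>R\<^esub>)" if "j < q" for j
  proof (cases "j = 0")
    case True
    then show ?thesis by (simp add: R.add.finprod_const)
  next
    case False
    have "(\<Oplus>\<^bsub>R\<^esub>i\<in>{..<q}. ?t i j) = (\<Oplus>\<^bsub>R\<^esub>i\<in>{..<q}. sc (zi [^]\<^bsub>F\<^esub> (i * j))) \<otimes>\<^bsub>R\<^esub> b [^]\<^bsub>R\<^esub> j"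
      by (rule R.finsum_ldistr[symmetric]) auto
    also have "(\<Oplus>\<^bsub>R\<^esub>i\<in>{..<q}. sc (zi [^]\<^bsub>F\<^esub> (i * j))) = sc \<zero>\<^bsub>F\<^esub>"
      using False that by (simp add: hom sum_powers_root del: sc.hom_zero)
    finally show ?thesis using False by simp
  qed
  have "(\<Oplus>\<^bsub>R\<^esub>i\<in>{..<q}. idem i) = sc k \<otimes>\<^bsub>R\<^esub> (\<Oplus>\<^bsub>R\<^esub>i\<in>{..<q}. \<Oplus>\<^bsub>R\<^esub>j\<in>{..<q}. ?t i j)"
    unfolding idem_def by (rule R.finsum_rdistr[symmetric]) (auto intro!: R.finsum_closed)
  also have "(\<Oplus>\<^bsub>R\<^esub>i\<in>{..<q}. \<Oplus>\<^bsub>R\<^esub>j\<in>{..<q}. ?t i j) = (\<Oplus>\<^bsub>R\<^esub>j\<in>{..<q}. \<Oplus>\<^bsub>R\<^esub>i\<in>{..<q}. ?t i j)"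
    by (rule R.finsum_swap) auto
  also have "\<dots> = (\<Oplus>\<^bsub>R\<^esub>j\<in>{..<q}. if 0 = j then [q] \<cdot>\<^bsub>R\<^esub> \<one>\<^bsub>R\<^esub> else \<zero>\<^bsub>R\<^esub>)"
    by (rule R.finsum_cong') (auto simp: col)
  also have "\<dots> = [q] \<cdot>\<^bsub>R\<^esub> \<one>\<^bsub>R\<^esub>"
    using R.finsum_singleton[of 0 "{..<q}" "\<lambda>_. [q] \<cdot>\<^bsub>R\<^esub> \<one>\<^bsub>R\<^esub>"] q0 by auto
  finally show ?thesis by (simp add: scalar_q_k)
qed

text \<open>The idempotents sum to one, so an element is the sum of its components.\<close>

lemma eq_by_idem:
  assumes "x \<in> carrier R" "y \<in> carrier R" "\<And>i. i < q \<Longrightarrow> idem i \<otimes>\<^bsub>R\<^esub> x = idem i \<otimes>\<^bsub>R\<^esub> y"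
  shows "x = y"
proof -
  have dec: "u = (\<Oplus>\<^bsub>R\<^esub>i\<in>{..<q}. idem i \<otimes>\<^bsub>R\<^esub> u)" if "u \<in> carrier R" for u
  proof -
    have "(\<Oplus>\<^bsub>R\<^esub>i\<in>{..<q}. idem i) \<otimes>\<^bsub>R\<^esub> u = (\<Oplus>\<^bsub>R\<^esub>i\<in>{..<q}. idem i \<otimes>\<^bsub>R\<^esub> u)"
      by (rule R.finsum_ldistr) (use that in auto)
    then show ?thesis using that by (simp add: sum_idem)
  qed
  have "x = (\<Oplus>\<^bsub>R\<^esub>i\<in>{..<q}. idem i \<otimes>\<^bsub>R\<^esub> x)" by (rule dec) fact
  also have "\<dots> = (\<Oplus>\<^bsub>R\<^esub>i\<in>{..<q}. idem i \<otimes>\<^bsub>R\<^esub> y)"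
    by (rule R.finsum_cong') (use assms in auto)
  also have "\<dots> = y" by (rule dec[symmetric]) fact
  finally show ?thesis .
qed

text \<open>On each component \<open>b\<close> acts as a scalar, so commuting with all idempotents
  suffices. The index 0 is left out because \<open>idem 0\<close> is one minus the others; this
  matters since the involution for index 0 has augmentation minus one.\<close>

lemma commutes_b:
  assumes x: "x \<in> carrier R"
    and comm: "\<And>i. 0 < i \<Longrightarrow> i < q \<Longrightarrow> x \<otimes>\<^bsub>R\<^esub> idem i = idem i \<otimes>\<^bsub>R\<^esub> x"
  shows "x \<otimes>\<^bsub>R\<^esub> b = b \<otimes>\<^bsub>R\<^esub> x"
proof -
  have q0: "{..<q} = insert 0 {0<..<q}" using k_q by (cases q) (auto simp: F.zero_not_one)
  let ?S = "\<Oplus>\<^bsub>R\<^esub>i\<in>{0<..<q}. x \<otimes>\<^bsub>R\<^esub> idem i"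
  have S: "?S \<in> carrier R" using x by (auto intro!: R.finsum_closed)
  have "x \<otimes>\<^bsub>R\<^esub> idem 0 \<oplus>\<^bsub>R\<^esub> ?S = (\<Oplus>\<^bsub>R\<^esub>i\<in>{..<q}. x \<otimes>\<^bsub>R\<^esub> idem i)"
    unfolding q0 by (rule R.finsum_insert[symmetric]) (use x in auto)
  also have "\<dots> = x \<otimes>\<^bsub>R\<^esub> (\<Oplus>\<^bsub>R\<^esub>i\<in>{..<q}. idem i)"
    by (rule R.finsum_rdistr[symmetric]) (use x in auto)
  also have "\<dots> = (\<Oplus>\<^bsub>R\<^esub>i\<in>{..<q}. idem i) \<otimes>\<^bsub>R\<^esub> x" using x by (simp add: sum_idem)
  also have "\<dots> = (\<Oplus>\<^bsub>R\<^esub>i\<in>{..<q}. idem i \<otimes>\<^bsub>R\<^esub> x)"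
    by (rule R.finsum_ldistr) (use x in auto)
  also have "\<dots> = idem 0 \<otimes>\<^bsub>R\<^esub> x \<oplus>\<^bsub>R\<^esub> (\<Oplus>\<^bsub>R\<^esub>i\<in>{0<..<q}. idem i \<otimes>\<^bsub>R\<^esub> x)"
    unfolding q0 by (rule R.finsum_insert) (use x in auto)
  also have "(\<Oplus>\<^bsub>R\<^esub>i\<in>{0<..<q}. idem i \<otimes>\<^bsub>R\<^esub> x) = ?S"
    by (rule R.finsum_cong') (use x comm in auto)
  finally have "x \<otimes>\<^bsub>R\<^esub> idem 0 = idem 0 \<otimes>\<^bsub>R\<^esub> x" using x S by simp
  then have comm': "x \<otimes>\<^bsub>R\<^esub> idem i = idem i \<otimes>\<^bsub>R\<^esub> x" if "i < q" for i
    using comm that by (cases "i = 0") auto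
  show ?thesis
  proof (rule eq_by_idem)
    fix i assume i: "i < q"
    have "idem i \<otimes>\<^bsub>R\<^esub> (x \<otimes>\<^bsub>R\<^esub> b) = x \<otimes>\<^bsub>R\<^esub> (idem i \<otimes>\<^bsub>R\<^esub> b)"
      using comm'[OF i] x by (simp add: R.m_assoc[symmetric])
    also have "\<dots> = sc (z [^]\<^bsub>F\<^esub> i) \<otimes>\<^bsub>R\<^esub> (idem i \<otimes>\<^bsub>R\<^esub> x)"
      using x comm'[OF i] by (simp only: idem_b scalar_left F.nat_pow_closed z idem_closed)
    also have "\<dots> = idem i \<otimes>\<^bsub>R\<^esub> (b \<otimes>\<^bsub>R\<^esub> x)"
      using x by (simp add: R.m_assoc[symmetric] idem_b)
    finally show "idem i \<otimes>\<^bsub>R\<^esub> (x \<otimes>\<^bsub>R\<^esub> b) = idem i \<otimes>\<^bsub>R\<^esub> (b \<otimes>\<^bsub>R\<^esub> x)" .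
  qed (use x in auto)
qed

text \<open>Applying \<open>h\<close> to \<open>b_idem\<close> shows that \<open>h (idem i)\<close>
  is unchanged by a factor different from one. The augmentation is the map in mind.\<close>

lemma hom_idem:
  assumes h: "ring_hom_ring R F h" and hb: "h b = \<one>\<^bsub>F\<^esub>"
    and hs: "\<And>c. c \<in> carrier F \<Longrightarrow> h (sc c) = c" and i: "0 < i" "i < q"
  shows "h (idem i) = \<zero>\<^bsub>F\<^esub>"
proof -
  interpret h: ring_hom_ring R F h by fact
  have "h (b \<otimes>\<^bsub>R\<^esub> idem i) = h (sc (z [^]\<^bsub>F\<^esub> i) \<otimes>\<^bsub>R\<^esub> idem i)" by (simp only: b_idem)
  then have "\<one>\<^bsub>F\<^esub> \<otimes>\<^bsub>F\<^esub> h (idem i) = z [^]\<^bsub>F\<^esub> i \<otimes>\<^bsub>F\<^esub> h (idem i)"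
    using hs[of "z [^]\<^bsub>F\<^esub> i"] by (simp add: hb del: sc.hom_nat_pow)
  then show ?thesis using primitive[OF i] by (metis F.m_rcancel F.nat_pow_closed F.one_closed h.hom_closed idem_closed z)
qed

section \<open>Involutions attached to the idempotents\<close>

definition reflection :: "nat \<Rightarrow> 'r" where "reflection i = \<one>\<^bsub>R\<^esub> \<ominus>\<^bsub>R\<^esub> (idem i \<oplus>\<^bsub>R\<^esub> idem i)"

lemma reflection_closed [simp]: "reflection i \<in> carrier R"
  by (simp add: reflection_def)

text \<open>For \<open>d = 2 e\<close> with \<open>e\<close> idempotent, the square of
  \<open>d\<close> is \<open>2 d\<close>, and this cancels the middle term in the square of
  \<open>1 - d\<close>.\<close>

lemma reflection_reflection: "reflection i \<otimes>\<^bsub>R\<^esub> reflection i = \<one>\<^bsub>R\<^esub>"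
proof -
  let ?d = "idem i \<oplus>\<^bsub>R\<^esub> idem i"
  have "?d \<otimes>\<^bsub>R\<^esub> ?d = ?d \<oplus>\<^bsub>R\<^esub> ?d" by (simp add: R.l_distr R.r_distr idem_idem)
  moreover have "(\<one>\<^bsub>R\<^esub> \<ominus>\<^bsub>R\<^esub> d) \<otimes>\<^bsub>R\<^esub> (\<one>\<^bsub>R\<^esub> \<ominus>\<^bsub>R\<^esub> d) = \<one>\<^bsub>R\<^esub>"
    if "d \<in> carrier R" "d \<otimes>\<^bsub>R\<^esub> d = d \<oplus>\<^bsub>R\<^esub> d" for d
  proof -
    let ?n = "\<ominus>\<^bsub>R\<^esub> d"
    have n: "?n \<in> carrier R" using that by simp
    have "(\<one>\<^bsub>R\<^esub> \<oplus>\<^bsub>R\<^esub> ?n) \<otimes>\<^bsub>R\<^esub> (\<one>\<^bsub>R\<^esub> \<oplus>\<^bsub>R\<^esub> ?n) = (\<one>\<^bsub>R\<^esub> \<oplus>\<^bsub>R\<^esub> ?n) \<oplus>\<^bsub>R\<^esub> (?n \<oplus>\<^bsub>R\<^esub> ?n \<otimes>\<^bsub>R\<^esub> ?n)"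
      using n by (simp only: R.r_distr R.l_distr R.a_closed R.one_closed R.r_one R.l_one)
    also have "?n \<otimes>\<^bsub>R\<^esub> ?n = d \<oplus>\<^bsub>R\<^esub> d"
      using that by (simp add: R.l_minus R.r_minus)
    also have "?n \<oplus>\<^bsub>R\<^esub> (d \<oplus>\<^bsub>R\<^esub> d) = d"
      using that(1) by (simp add: R.a_assoc[symmetric] R.l_neg)
    also have "(\<one>\<^bsub>R\<^esub> \<oplus>\<^bsub>R\<^esub> ?n) \<oplus>\<^bsub>R\<^esub> d = \<one>\<^bsub>R\<^esub>"
      using that(1) by (simp add: R.a_assoc R.l_neg)
    finally show ?thesis by (simp only: R.minus_eq)
  qed
  ultimately show ?thesis by (simp add: reflection_def)
qed

text \<open>Commuting with \<open>1 - 2 e\<close> amounts to equality of \<open>2 x e\<close> and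
  \<open>2 e x\<close>, from which the nonzero scalar 2 can be cancelled.\<close>

lemma reflection_commutes_iff:
  assumes x: "x \<in> carrier R" and two: "\<one>\<^bsub>F\<^esub> \<oplus>\<^bsub>F\<^esub> \<one>\<^bsub>F\<^esub> \<noteq> \<zero>\<^bsub>F\<^esub>"
  shows "x \<otimes>\<^bsub>R\<^esub> reflection i = reflection i \<otimes>\<^bsub>R\<^esub> x \<longleftrightarrow> x \<otimes>\<^bsub>R\<^esub> idem i = idem i \<otimes>\<^bsub>R\<^esub> x"
proof -
  let ?u = "x \<otimes>\<^bsub>R\<^esub> idem i" and ?v = "idem i \<otimes>\<^bsub>R\<^esub> x"
  have "x \<otimes>\<^bsub>R\<^esub> reflection i = x \<ominus>\<^bsub>R\<^esub> (?u \<oplus>\<^bsub>R\<^esub> ?u)" "reflection i \<otimes>\<^bsub>R\<^esub> x = x \<ominus>\<^bsub>R\<^esub> (?v \<oplus>\<^bsub>R\<^esub> ?v)"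
    using x by (simp_all add: reflection_def R.minus_eq R.l_distr R.r_distr R.l_minus R.r_minus)
  moreover have "?u = ?v" if "?u \<oplus>\<^bsub>R\<^esub> ?u = ?v \<oplus>\<^bsub>R\<^esub> ?v"
  proof -
    let ?c = "\<one>\<^bsub>F\<^esub> \<oplus>\<^bsub>F\<^esub> \<one>\<^bsub>F\<^esub>"
    have uv: "?u \<in> carrier R" "?v \<in> carrier R" using x by auto
    have dbl: "sc ?c \<otimes>\<^bsub>R\<^esub> w = w \<oplus>\<^bsub>R\<^esub> w" if "w \<in> carrier R" for w
      using that by (simp add: R.l_distr)
    have "sc ?c \<otimes>\<^bsub>R\<^esub> ?u = sc ?c \<otimes>\<^bsub>R\<^esub> ?v" using that by (simp only: dbl[OF uv(1)] dbl[OF uv(2)])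
    moreover have "sc ?c \<otimes>\<^bsub>R\<^esub> (s \<ominus>\<^bsub>R\<^esub> t) = sc \<zero>\<^bsub>F\<^esub> \<otimes>\<^bsub>R\<^esub> (s \<ominus>\<^bsub>R\<^esub> t)"
      if "s \<in> carrier R" "t \<in> carrier R" "sc ?c \<otimes>\<^bsub>R\<^esub> s = sc ?c \<otimes>\<^bsub>R\<^esub> t" for s t
    proof -
      have c: "sc ?c \<in> carrier R" by (intro sc.hom_closed) auto
      have "sc ?c \<otimes>\<^bsub>R\<^esub> (s \<ominus>\<^bsub>R\<^esub> t) = sc ?c \<otimes>\<^bsub>R\<^esub> s \<ominus>\<^bsub>R\<^esub> sc ?c \<otimes>\<^bsub>R\<^esub> t"
        using that(1,2) c by (simp only: R.minus_eq R.r_distr R.r_minus R.a_inv_closed)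
      then show ?thesis using that(1,2) c unfolding that(3) by (simp add: R.minus_eq R.r_neg)
    qed
    ultimately have "sc ?c \<otimes>\<^bsub>R\<^esub> (?u \<ominus>\<^bsub>R\<^esub> ?v) = sc \<zero>\<^bsub>F\<^esub> \<otimes>\<^bsub>R\<^esub> (?u \<ominus>\<^bsub>R\<^esub> ?v)"
      using uv by blast
    then have "?u \<ominus>\<^bsub>R\<^esub> ?v = \<zero>\<^bsub>R\<^esub>"
      using two uv by (intro scalar_cancel[of ?c "\<zero>\<^bsub>F\<^esub>"]) auto
    then show ?thesis using uv by simp
  qed
  moreover have "s = t" if "x \<ominus>\<^bsub>R\<^esub> s = x \<ominus>\<^bsub>R\<^esub> t" "s \<in> carrier R" "t \<in> carrier R" for s t
    using that x by (metis R.a_inv_closed R.add.l_cancel R.minus_eq R.minus_minus)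
  ultimately show ?thesis using x by (metis R.a_closed R.m_closed idem_closed)
qed

text \<open>If \<open>z\<close> has a \<open>q\<close>-th root \<open>y\<close>, replacing the
  eigenvalues of \<open>b\<close> by the corresponding powers of \<open>y\<close> gives
  \<open>u\<close>; its \<open>q\<close>-th power has the eigenvalues of \<open>b\<close>
  again.\<close>

lemma ex_root:
  assumes y: "y \<in> carrier F" "y [^]\<^bsub>F\<^esub> q = z"
  shows "\<exists>u\<in>carrier R. u [^]\<^bsub>R\<^esub> q = b"
proof -
  define u where "u = (\<Oplus>\<^bsub>R\<^esub>j\<in>{..<q}. sc (y [^]\<^bsub>F\<^esub> j) \<otimes>\<^bsub>R\<^esub> idem j)"
  have u: "u \<in> carrier R" using y by (auto simp: u_def intro!: R.finsum_closed)
  have iu: "idem i \<otimes>\<^bsub>R\<^esub> u = sc (y [^]\<^bsub>F\<^esub> i) \<otimes>\<^bsub>R\<^esub> idem i" if i: "i < q" for i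
  proof -
    have "idem i \<otimes>\<^bsub>R\<^esub> u = (\<Oplus>\<^bsub>R\<^esub>j\<in>{..<q}. idem i \<otimes>\<^bsub>R\<^esub> (sc (y [^]\<^bsub>F\<^esub> j) \<otimes>\<^bsub>R\<^esub> idem j))"
      unfolding u_def by (rule R.finsum_rdistr) (use y in auto)
    also have "\<dots> = (\<Oplus>\<^bsub>R\<^esub>j\<in>{..<q}. if i = j then sc (y [^]\<^bsub>F\<^esub> j) \<otimes>\<^bsub>R\<^esub> idem j else \<zero>\<^bsub>R\<^esub>)"
      by (rule R.finsum_cong') (use y i in \<open>auto simp: scalar_left idem_idem idem_orthogonal\<close>)
    also have "\<dots> = sc (y [^]\<^bsub>F\<^esub> i) \<otimes>\<^bsub>R\<^esub> idem i"
      by (rule R.finsum_singleton) (use y i in auto)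
    finally show ?thesis .
  qed
  have pow: "idem i \<otimes>\<^bsub>R\<^esub> u [^]\<^bsub>R\<^esub> m = sc (y [^]\<^bsub>F\<^esub> (i * m)) \<otimes>\<^bsub>R\<^esub> idem i" if i: "i < q" for i m
  proof (induction m)
    case (Suc m)
    have "idem i \<otimes>\<^bsub>R\<^esub> u [^]\<^bsub>R\<^esub> Suc m = (idem i \<otimes>\<^bsub>R\<^esub> u [^]\<^bsub>R\<^esub> m) \<otimes>\<^bsub>R\<^esub> u"
      using u by (simp add: R.m_assoc)
    also have "\<dots> = sc (y [^]\<^bsub>F\<^esub> (i * m)) \<otimes>\<^bsub>R\<^esub> (sc (y [^]\<^bsub>F\<^esub> i) \<otimes>\<^bsub>R\<^esub> idem i)"
      unfolding Suc using u y i by (simp add: R.m_assoc iu)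
    also have "\<dots> = sc (y [^]\<^bsub>F\<^esub> (i * Suc m)) \<otimes>\<^bsub>R\<^esub> idem i"
      using y by (subst scalar_mult_assoc) (auto simp: F.nat_pow_mult add.commute)
    finally show ?case .
  qed simp
  have "u [^]\<^bsub>R\<^esub> q = b"
  proof (rule eq_by_idem)
    fix i assume i: "i < q"
    have "y [^]\<^bsub>F\<^esub> (i * q) = z [^]\<^bsub>F\<^esub> i"
      using y by (simp add: mult.commute[of i] F.nat_pow_pow[symmetric])
    then show "idem i \<otimes>\<^bsub>R\<^esub> u [^]\<^bsub>R\<^esub> q = idem i \<otimes>\<^bsub>R\<^esub> b" using i by (simp only: pow idem_b)
  qed (use u in auto)
  then show ?thesis using u by blast
qed

end

section \<open>Orders of elements and roots of unity\<close>

lemma (in group) pow_eq_one_coprime: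
  assumes "x \<in> carrier G" "x [^] (m::nat) = \<one>" "x [^] (n::nat) = \<one>" "coprime m n"
  shows "x = \<one>"
proof -
  have "ord x dvd m" "ord x dvd n" using assms pow_eq_id by auto
  then have "ord x = 1" using assms(4) by (metis coprime_common_divisor_nat)
  then show ?thesis using assms(1) pow_ord_eq_1[of x] by simp
qed

lemma (in group) int_pow_commutes:
  assumes "x \<in> carrier G"
  shows "x [^] (i::int) \<otimes> x = x \<otimes> x [^] i"
proof -
  have "x [^] i \<otimes> x [^] (1::int) = x [^] (1::int) \<otimes> x [^] i"
    using assms by (simp only: int_pow_mult[symmetric] add.commute)
  then show ?thesis using assms by simp
qed

lemma (in monoid) pow_eq_one_Units:
  assumes "x \<in> carrier G" "x [^] (n::nat) = \<one>" "0 < n"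
  shows "x \<in> Units G"
proof -
  obtain m where "n = Suc m" using assms(3) gr0_implies_Suc by blast
  then have "x [^] m \<otimes> x = \<one>" "x \<otimes> x [^] m = \<one>"
    using assms(1,2) by (simp, metis nat_pow_Suc2)
  then show ?thesis using assms(1) unfolding Units_def by blast
qed

text \<open>Lagrange in the additive group shows that \<open>p ^ f\<close> annihilates one; since a
  field has no zero divisors, a factor \<open>p\<close> already does. Exponent 0 would make one
  equal to zero.\<close>

lemma (in field) prime_char_of_order:
  assumes "order R = p ^ f" "0 < p"
  shows "[(p::nat)] \<cdot> \<one> = \<zero>"
proof -
  have "[order R] \<cdot> \<one> = \<zero>"
    using add.pow_order_eq_1[of \<one>] by (simp add: order_def)
  then have "[(p ^ f)] \<cdot> \<one> = \<zero>" by (simp add: assms)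
  then show ?thesis
  proof (induction f)
    case (Suc f)
    have "[(p ^ Suc f)] \<cdot> \<one> = ([p] \<cdot> \<one>) \<otimes> ([(p ^ f)] \<cdot> \<one>)"
      by (simp add: add_pow_ldistr add_pow_rdistr add.nat_pow_pow mult.commute)
    then show ?case using Suc by (metis add.nat_pow_closed integral one_closed)
  qed (use zero_not_one in auto)
qed

text \<open>The multiplicative group is cyclic of order \<open>order R - 1\<close>; the witness is
  its generator raised to the cofactor of \<open>d\<close>.\<close>

lemma (in field) ex_primitive_root:
  assumes fin: "finite (carrier R)" and d: "d dvd order R - 1"
  shows "\<exists>z\<in>carrier R. z [^] d = \<one> \<and> (\<forall>i. 0 < i \<longrightarrow> i < d \<longrightarrow> z [^] (i::nat) \<noteq> \<one>)"
proof -
  interpret M: group "Multiplicative_Group.mult_of R" by (rule field_mult_group)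
  have finM: "finite (carrier (Multiplicative_Group.mult_of R))" using finite_mult_of[OF fin] .
  let ?N = "order R - 1"
  have N: "order (Multiplicative_Group.mult_of R) = ?N" using order_mult_of[OF fin] .
  have N0: "0 < ?N" using M.order_gt_0_iff_finite finM N by simp
  obtain a where a: "a \<in> carrier (Multiplicative_Group.mult_of R)" "carrier (Multiplicative_Group.mult_of R) = {a [^] i | i::nat. i \<in> UNIV}"
    using finite_field_mult_group_has_gen[OF fin] by blast
  have "carrier (Multiplicative_Group.mult_of R) = generate (Multiplicative_Group.mult_of R) {a}"
    using M.generate_pow_nat[OF a(1)] M.ord_ge_1[OF finM a(1)] a(2) by (auto simp: Multiplicative_Group.mult_of_simps)
  then have ord: "M.ord a = ?N" using M.generate_pow_card[OF a(1)] N by (simp add: order_def)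
  obtain e where e: "?N = d * e" using d by blast
  then have e0: "0 < e" using N0 by (cases e) auto
  have aR: "a \<in> carrier R" using a(1) by (simp add: Multiplicative_Group.mult_of_simps)
  have iff: "a [^] i = \<one> \<longleftrightarrow> ?N dvd i" for i :: nat
    using M.pow_eq_id[OF a(1), of i] ord by (simp add: Multiplicative_Group.mult_of_simps)
  have "(a [^] e) [^] d = \<one>" using aR iff e by (simp add: nat_pow_pow mult.commute)
  moreover have "(a [^] e) [^] i \<noteq> \<one>" if "0 < i" "i < d" for i :: nat
    using aR iff[of "e * i"] e e0 that by (simp add: nat_pow_pow mult.commute[of d]) (auto dest: dvd_imp_le)
  ultimately show ?thesis using aR by (intro bexI[of _ "a [^] e"]) auto
qed

section \<open>Normalized units\<close>

context finite_group_algebra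
begin

abbreviation "V \<equiv> normalized_units F G"

lemma normalized_units_simps [simp]:
  "u \<in> carrier V \<longleftrightarrow> u \<in> Units R \<and> augmentation F G u = \<one>\<^bsub>F\<^esub>"
  "u \<otimes>\<^bsub>V\<^esub> v = u \<otimes>\<^bsub>R\<^esub> v" "\<one>\<^bsub>V\<^esub> = \<one>\<^bsub>R\<^esub>"
  by (auto simp: normalized_units_def units_of_def)

lemma normalized_units_pow [simp]: "u [^]\<^bsub>V\<^esub> (n::nat) = u [^]\<^bsub>R\<^esub> n"
  by (induction n) (auto simp: nat_pow_def)

lemma emb_pow: "g \<in> carrier G \<Longrightarrow> emb g [^]\<^bsub>R\<^esub> (n::nat) = emb (g [^]\<^bsub>G\<^esub> n)"
  by (induction n) (auto simp: emb_one emb_mult)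

lemma emb_hom: "emb \<in> hom G V"
proof (rule homI)
  fix g assume g: "g \<in> carrier G"
  have "emb (inv\<^bsub>G\<^esub> g) \<otimes>\<^bsub>R\<^esub> emb g = \<one>\<^bsub>R\<^esub>" "emb g \<otimes>\<^bsub>R\<^esub> emb (inv\<^bsub>G\<^esub> g) = \<one>\<^bsub>R\<^esub>"
    using g by (simp_all add: emb_mult[symmetric] emb_one)
  then have "emb g \<in> Units R" unfolding Units_def by (auto intro!: bexI[of _ "emb (inv\<^bsub>G\<^esub> g)"])
  then show "emb g \<in> carrier V" using g by (simp add: embed_monomial augmentation_monomial)
qed (simp add: emb_mult)

lemma augmentation_emb: "g \<in> carrier G \<Longrightarrow> augmentation F G (emb g) = \<one>\<^bsub>F\<^esub>"
  by (simp add: embed_monomial augmentation_monomial)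

text \<open>For \<open>a\<close> in a normal subgroup the conjugate stays in it, so differences
  \<open>a - 1\<close> can be moved past group elements.\<close>

lemma emb_conj_diff:
  assumes "a \<in> carrier G" "g \<in> carrier G"
  shows "(emb a \<ominus>\<^bsub>R\<^esub> \<one>\<^bsub>R\<^esub>) \<otimes>\<^bsub>R\<^esub> emb g = emb g \<otimes>\<^bsub>R\<^esub> (emb (inv\<^bsub>G\<^esub> g \<otimes>\<^bsub>G\<^esub> a \<otimes>\<^bsub>G\<^esub> g) \<ominus>\<^bsub>R\<^esub> \<one>\<^bsub>R\<^esub>)"
proof -
  have "emb g \<otimes>\<^bsub>R\<^esub> emb (inv\<^bsub>G\<^esub> g \<otimes>\<^bsub>G\<^esub> a \<otimes>\<^bsub>G\<^esub> g) = emb a \<otimes>\<^bsub>R\<^esub> emb g"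
    using assms by (simp add: emb_mult[symmetric] G.m_assoc[symmetric])
  then show ?thesis by (simp add: R.minus_eq R.l_distr R.r_distr R.l_minus R.r_minus)
qed

text \<open>\<open>P\<close> consists of the normalized units congruent to one modulo the two-sided
  ideal \<open>I\<close> generated by all \<open>a - 1\<close>. Two-sidedness makes \<open>P\<close>
  a normal subgroup; nilpotency of the elements of \<open>I\<close> makes every order a power of
  \<open>p\<close>.\<close>

lemma normal_p_subgroup_of_units:
  assumes V: "group V" and p: "Factorial_Ring.prime (p::nat)" and char: "[p] \<cdot>\<^bsub>F\<^esub> \<one>\<^bsub>F\<^esub> = \<zero>\<^bsub>F\<^esub>"
    and finF: "finite (carrier F)"
    and A: "A \<lhd> G" and comm: "\<And>a a'. a \<in> A \<Longrightarrow> a' \<in> A \<Longrightarrow> a \<otimes>\<^bsub>G\<^esub> a' = a' \<otimes>\<^bsub>G\<^esub> a"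
    and exp: "\<And>a. a \<in> A \<Longrightarrow> a [^]\<^bsub>G\<^esub> (p ^ n) = \<one>\<^bsub>G\<^esub>"
  obtains P where "P \<lhd> V" "emb ` A \<subseteq> P" "\<And>x. x \<in> P \<Longrightarrow> \<exists>j. x [^]\<^bsub>V\<^esub> (p ^ j) = \<one>\<^bsub>V\<^esub>"
proof -
  interpret V: group V by fact
  interpret A: normal A G by fact
  interpret sc: ring_hom_ring F R scalar by (rule scalar_hom)
  interpret aug: ring_hom_ring R F "augmentation F G" by (rule augmentation_hom)
  have AG: "a \<in> carrier G" if "a \<in> A" for a using A.mem_carrier that by simp
  define S where "S = (\<lambda>a. emb a \<ominus>\<^bsub>R\<^esub> \<one>\<^bsub>R\<^esub>) ` A"
  have S: "S \<subseteq> carrier R" by (auto simp: S_def)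
  define I where "I = Idl\<^bsub>R\<^esub> S"
  interpret I: ideal I R unfolding I_def by (rule R.genideal_ideal[OF S])
  have charR: "[p] \<cdot>\<^bsub>R\<^esub> \<one>\<^bsub>R\<^esub> = \<zero>\<^bsub>R\<^esub>"
  proof -
    have "scalar ([m] \<cdot>\<^bsub>F\<^esub> \<one>\<^bsub>F\<^esub>) = [m] \<cdot>\<^bsub>R\<^esub> \<one>\<^bsub>R\<^esub>" for m :: nat
      by (induction m) auto
    then show ?thesis using char by (metis sc.hom_zero)
  qed
  have unip: "x = \<one>\<^bsub>R\<^esub> \<oplus>\<^bsub>R\<^esub> (x \<ominus>\<^bsub>R\<^esub> \<one>\<^bsub>R\<^esub>)" if "x \<in> carrier R" for x
    using that by (simp add: R.minus_eq R.a_assoc[symmetric] R.a_comm[of "\<one>\<^bsub>R\<^esub>" x] R.r_neg R.a_assoc)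
  have nil: "\<exists>N::nat. y [^]\<^bsub>R\<^esub> N = \<zero>\<^bsub>R\<^esub>" if "y \<in> I" for y
  proof (rule R.nil_genideal)
    show "finite (carrier R)" unfolding carrier_R using fin finF by (intro finite_PiE)
    show "S \<subseteq> carrier R" by (rule S)
    show "y \<in> Idl\<^bsub>R\<^esub> S" using that by (simp add: I_def)
  next
    fix d d' assume "d \<in> S" "d' \<in> S"
    then obtain a a' where a: "a \<in> A" "a' \<in> A" "d = emb a \<ominus>\<^bsub>R\<^esub> \<one>\<^bsub>R\<^esub>" "d' = emb a' \<ominus>\<^bsub>R\<^esub> \<one>\<^bsub>R\<^esub>"
      by (auto simp: S_def)
    have dR: "d \<in> carrier R" using a by simp
    have "d \<otimes>\<^bsub>R\<^esub> emb a' = emb a' \<otimes>\<^bsub>R\<^esub> d"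
      using emb_conj_diff[OF AG AG, OF a(1,2)] a AG comm[OF a(1,2)] by (simp add: G.m_assoc) (simp add: G.m_assoc[symmetric])
    then show "d \<otimes>\<^bsub>R\<^esub> d' = d' \<otimes>\<^bsub>R\<^esub> d"
      using dR unfolding a(4) by (simp add: R.minus_eq R.l_distr R.r_distr R.l_minus R.r_minus)
  next
    fix d assume "d \<in> S"
    then obtain a where a: "a \<in> A" "d = emb a \<ominus>\<^bsub>R\<^esub> \<one>\<^bsub>R\<^esub>" by (auto simp: S_def)
    have d: "d \<in> carrier R" using a by simp
    \<comment> \<open>Comparing \<open>a\<close> to the power \<open>p ^ n\<close>, which is one,
      with its expansion by \<open>freshman\<close> shows that \<open>d\<close> is
      nilpotent.\<close>
    have "\<one>\<^bsub>R\<^esub> = (\<one>\<^bsub>R\<^esub> \<oplus>\<^bsub>R\<^esub> d) [^]\<^bsub>R\<^esub> (p ^ n)"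
      using unip[of "emb a"] a AG exp[OF a(1)] by (simp add: emb_pow emb_one)
    also have "\<dots> = \<one>\<^bsub>R\<^esub> \<oplus>\<^bsub>R\<^esub> d [^]\<^bsub>R\<^esub> (p ^ n)" by (rule R.freshman[OF d p charR])
    finally have "d [^]\<^bsub>R\<^esub> (p ^ n) = \<zero>\<^bsub>R\<^esub>"
      using d by (metis R.add.l_cancel_one' R.nat_pow_closed R.one_closed)
    then show "\<exists>N::nat. d [^]\<^bsub>R\<^esub> N = \<zero>\<^bsub>R\<^esub>" by blast
  next
    fix K d r assume K: "left_ideal K R" and SK: "S \<subseteq> K" and d: "d \<in> S" and r: "r \<in> carrier R"
    have K': "\<zero>\<^bsub>R\<^esub> \<in> K" "\<And>x y. x \<in> K \<Longrightarrow> y \<in> K \<Longrightarrow> x \<oplus>\<^bsub>R\<^esub> y \<in> K"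
      "\<And>x y. x \<in> carrier R \<Longrightarrow> y \<in> K \<Longrightarrow> x \<otimes>\<^bsub>R\<^esub> y \<in> K"
      using K unfolding left_ideal_def by auto
    have dR: "d \<in> carrier R" using d S by auto
    \<comment> \<open>For fixed \<open>d\<close> the admissible \<open>r\<close> are closed under
      addition, so it suffices to take \<open>r = c g\<close>. There \<open>d\<close> moves past
      \<open>g\<close> into another generator, which lies in \<open>K\<close>.\<close>
    have "r \<in> {r \<in> carrier R. d \<otimes>\<^bsub>R\<^esub> r \<in> K}"
    proof (rule spanned_by_group[OF _ _ _ r])
      fix c g assume c: "c \<in> carrier F" and g: "g \<in> carrier G"
      obtain a where a: "a \<in> A" "d = emb a \<ominus>\<^bsub>R\<^esub> \<one>\<^bsub>R\<^esub>" using d by (auto simp: S_def)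
      have "inv\<^bsub>G\<^esub> g \<otimes>\<^bsub>G\<^esub> a \<otimes>\<^bsub>G\<^esub> g \<in> A" using A.inv_op_closed1 g a by simp
      then have "d \<otimes>\<^bsub>R\<^esub> emb g \<in> K"
        unfolding a(2) emb_conj_diff[OF AG[OF a(1)] g] using SK by (intro K'(3)) (auto simp: S_def)
      then have "scalar c \<otimes>\<^bsub>R\<^esub> (d \<otimes>\<^bsub>R\<^esub> emb g) \<in> K" by (rule K'(3)[OF monomial_closed[OF c]])
      also have "scalar c \<otimes>\<^bsub>R\<^esub> (d \<otimes>\<^bsub>R\<^esub> emb g) = d \<otimes>\<^bsub>R\<^esub> (scalar c \<otimes>\<^bsub>R\<^esub> emb g)"
        using c dR scalar_central[OF c dR] by (simp add: R.m_assoc[symmetric])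
      finally show "scalar c \<otimes>\<^bsub>R\<^esub> emb g \<in> {r \<in> carrier R. d \<otimes>\<^bsub>R\<^esub> r \<in> K}"
        using c by simp
    qed (use K' dR in \<open>auto simp: R.r_distr\<close>)
    then show "d \<otimes>\<^bsub>R\<^esub> r \<in> K" by simp
  qed
  define P where "P = {u \<in> carrier V. u \<ominus>\<^bsub>R\<^esub> \<one>\<^bsub>R\<^esub> \<in> I}"
  have VR: "u \<in> carrier R" if "u \<in> carrier V" for u using that by (simp add: R.Units_closed)
  have Iinv: "u \<in> carrier V \<Longrightarrow> inv\<^bsub>V\<^esub> u \<in> carrier R" for u using V.inv_closed VR by blast
  have conj: "v \<otimes>\<^bsub>R\<^esub> u \<otimes>\<^bsub>R\<^esub> inv\<^bsub>V\<^esub> v \<ominus>\<^bsub>R\<^esub> \<one>\<^bsub>R\<^esub> = v \<otimes>\<^bsub>R\<^esub> (u \<ominus>\<^bsub>R\<^esub> \<one>\<^bsub>R\<^esub>) \<otimes>\<^bsub>R\<^esub> inv\<^bsub>V\<^esub> v"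
    if v: "v \<in> carrier V" and u: "u \<in> carrier R" for u v
  proof -
    have "v \<otimes>\<^bsub>R\<^esub> inv\<^bsub>V\<^esub> v = \<one>\<^bsub>R\<^esub>" using V.r_inv[OF v] by simp
    then show ?thesis using VR[OF v] Iinv[OF v] u
      by (simp add: R.minus_eq R.l_distr R.r_distr R.l_minus R.r_minus)
  qed
  have "subgroup P V"
  proof (rule V.subgroupI)
    show "P \<subseteq> carrier V" by (auto simp: P_def)
    have "\<one>\<^bsub>V\<^esub> \<in> P" using I.zero_closed V.one_closed by (auto simp: P_def R.minus_eq R.r_neg)
    then show "P \<noteq> {}" by blast
  next
    fix u assume u: "u \<in> P"
    then have uV: "u \<in> carrier V" by (simp add: P_def)
    have uR: "u \<in> carrier R" "inv\<^bsub>V\<^esub> u \<in> carrier R" using VR Iinv uV by auto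
    have "u \<otimes>\<^bsub>R\<^esub> inv\<^bsub>V\<^esub> u = \<one>\<^bsub>R\<^esub>" using V.r_inv[OF uV] by simp
    \<comment> \<open>The inverse differs from one by minus \<open>(u - 1)\<close> times the inverse
      of \<open>u\<close>, a member of \<open>I\<close>.\<close>
    then have "inv\<^bsub>V\<^esub> u \<ominus>\<^bsub>R\<^esub> \<one>\<^bsub>R\<^esub> = \<ominus>\<^bsub>R\<^esub> ((u \<ominus>\<^bsub>R\<^esub> \<one>\<^bsub>R\<^esub>) \<otimes>\<^bsub>R\<^esub> inv\<^bsub>V\<^esub> u)"
      using uR by (simp add: R.minus_eq R.l_distr R.l_minus R.minus_add R.a_comm)
    also have "\<dots> \<in> I" using u uR by (intro I.a_inv_closed I.I_r_closed) (auto simp: P_def)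
    finally show "inv\<^bsub>V\<^esub> u \<in> P" using V.inv_closed[OF uV] by (simp add: P_def del: normalized_units_simps)
  next
    fix u v assume uv: "u \<in> P" "v \<in> P"
    then have V': "u \<in> carrier V" "v \<in> carrier V" by (auto simp: P_def)
    have R': "u \<in> carrier R" "v \<in> carrier R" using VR V' by auto
    have "u \<otimes>\<^bsub>R\<^esub> v \<ominus>\<^bsub>R\<^esub> \<one>\<^bsub>R\<^esub> = (u \<ominus>\<^bsub>R\<^esub> \<one>\<^bsub>R\<^esub>) \<otimes>\<^bsub>R\<^esub> v \<oplus>\<^bsub>R\<^esub> (v \<ominus>\<^bsub>R\<^esub> \<one>\<^bsub>R\<^esub>)"
      using R' by (simp add: R.minus_eq R.l_distr R.l_minus R.a_assoc)
        (simp add: R.a_assoc[symmetric] R.l_neg)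
    also have "\<dots> \<in> I" using uv R' by (intro I.a_closed I.I_r_closed) (auto simp: P_def)
    finally have "u \<otimes>\<^bsub>V\<^esub> v \<ominus>\<^bsub>R\<^esub> \<one>\<^bsub>R\<^esub> \<in> I" by simp
    then show "u \<otimes>\<^bsub>V\<^esub> v \<in> P" using V.m_closed[OF V'] unfolding P_def by blast
  qed
  then have "P \<lhd> V"
  proof (rule V.normal_invI)
    fix v u assume v: "v \<in> carrier V" and u: "u \<in> P"
    have uV: "u \<in> carrier V" and uI: "u \<ominus>\<^bsub>R\<^esub> \<one>\<^bsub>R\<^esub> \<in> I" using u by (auto simp: P_def)
    have "v \<otimes>\<^bsub>V\<^esub> u \<otimes>\<^bsub>V\<^esub> inv\<^bsub>V\<^esub> v \<ominus>\<^bsub>R\<^esub> \<one>\<^bsub>R\<^esub> = v \<otimes>\<^bsub>R\<^esub> (u \<ominus>\<^bsub>R\<^esub> \<one>\<^bsub>R\<^esub>) \<otimes>\<^bsub>R\<^esub> inv\<^bsub>V\<^esub> v"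
      using conj[OF v VR[OF uV]] by simp
    also have "\<dots> \<in> I" using uI VR[OF v] Iinv[OF v] by (intro I.I_l_closed I.I_r_closed)
    finally show "v \<otimes>\<^bsub>V\<^esub> u \<otimes>\<^bsub>V\<^esub> inv\<^bsub>V\<^esub> v \<in> P"
      using v uV unfolding P_def by (blast intro: V.m_closed V.inv_closed)
  qed
  moreover have "emb ` A \<subseteq> P"
  proof (rule image_subsetI)
    fix a assume a: "a \<in> A"
    have "emb a \<ominus>\<^bsub>R\<^esub> \<one>\<^bsub>R\<^esub> \<in> I" unfolding I_def using R.genideal_self[OF S] a by (auto simp: S_def)
    then show "emb a \<in> P" using emb_hom AG[OF a] unfolding P_def hom_def by blast
  qed
  moreover have "\<exists>j. x [^]\<^bsub>V\<^esub> (p ^ j) = \<one>\<^bsub>V\<^esub>" if x: "x \<in> P" for x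
  proof -
    have xR: "x \<in> carrier R" using x VR by (auto simp: P_def)
    obtain N :: nat where "(x \<ominus>\<^bsub>R\<^esub> \<one>\<^bsub>R\<^esub>) [^]\<^bsub>R\<^esub> N = \<zero>\<^bsub>R\<^esub>" using nil x by (auto simp: P_def)
    then have "\<exists>j. (\<one>\<^bsub>R\<^esub> \<oplus>\<^bsub>R\<^esub> (x \<ominus>\<^bsub>R\<^esub> \<one>\<^bsub>R\<^esub>)) [^]\<^bsub>R\<^esub> (p ^ j) = \<one>\<^bsub>R\<^esub>"
      using xR p charR by (intro R.unipotent_pow) auto
    then show ?thesis by (simp add: unip[OF xR, symmetric])
  qed
  ultimately show thesis by (rule that)
qed

end

theorem theorem1p1:
  fixes F :: "('f, 'm) ring_scheme"
    and G :: "('g, 'n) monoid_scheme"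
    and A B :: "'g set" and b :: 'g
    and p f q s m n :: nat
  assumes "Factorial_Ring.prime p" and "odd p"
    and "field F" and "order F = p ^ f"
    and "Factorial_Ring.prime q" and "odd q" and "q dvd p ^ f - 1"
    and "0 < s" and "0 < m" and "p ^ f = s * q ^ m + 1" and "coprime s q"
    and "group G"
    and "b \<in> carrier G" and "B = generate G {b}" and "card B = q"
    and "A \<lhd> G" and "comm_group (G\<lparr>carrier := A\<rparr>)" and "card A = p ^ n"
    and "A \<inter> B = {\<one>\<^bsub>G\<^esub>}" and "A <#>\<^bsub>G\<^esub> B = carrier G"
    and "centralizer_in G A b = {\<one>\<^bsub>G\<^esub>}"
    and "m > 1 \<or> (s + 1 \<ge> q \<and> 2 * n \<ge> f * (q - 1))"
  shows "\<not> (\<exists>N. normal_complement (normalized_units F G)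
                  (group_algebra_embed F G ` carrier G) N)"
proof
  note p = assms(1) and q = assms(5)
  have p0: "0 < p" and q0: "0 < q" and q1: "1 < q"
    using prime_gt_0_nat[OF p] prime_gt_0_nat[OF q] prime_gt_1_nat[OF q] by auto
  interpret F: field F by fact
  interpret G: group G by fact
  interpret A: normal A G by fact
  have finA: "finite A" using assms(18) p0 by (metis card.infinite zero_less_power less_irrefl)
  have finB: "finite B" using assms(15) q0 by (metis card.infinite less_irrefl)
  have finG: "finite (carrier G)"
    using finA finB unfolding assms(20)[symmetric] set_mult_def by auto
  interpret finite_group_algebra F G by unfold_locales (rule finG)
  interpret sc: ring_hom_ring F R scalar by (rule scalar_hom)
  interpret aug: ring_hom_ring R F "augmentation F G" by (rule augmentation_hom)
  assume "\<exists>N. normal_complement (normalized_units F G) (group_algebra_embed F G ` carrier G) N"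
  then obtain N where N: "normal_complement V (emb ` carrier G) N" by blast
  then have V: "group V" unfolding normal_complement_def normal_def by blast
  obtain r where r: "r \<in> hom V G" and r_emb: "\<And>g. g \<in> carrier G \<Longrightarrow> r (emb g) = g"
    using normal_complement_retraction[OF V \<open>group G\<close> emb_hom emb_inj N] by blast
  interpret V: group V by fact
  interpret r: group_hom V G r by unfold_locales (rule r)

  \<comment> \<open>The centralizer of \<open>b\<close> in \<open>G\<close>\<close>
  have bG: "b \<in> carrier G" by fact
  have subB: "subgroup B G" unfolding assms(14) using bG by (intro G.generate_is_subgroup) simp
  have bB: "b \<in> B" unfolding assms(14) by (intro generate.incl) simp
  have B_pow: "g [^]\<^bsub>G\<^esub> q = \<one>\<^bsub>G\<^esub>" if "g \<in> B" for g
  proof -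
    interpret GB: group "G\<lparr>carrier := B\<rparr>" using subB by (rule G.subgroup_imp_group)
    show ?thesis using GB.pow_order_eq_1[of g] that assms(15)
      by (simp add: order_def nat_pow_def)
  qed
  have B_comm: "g \<otimes>\<^bsub>G\<^esub> b = b \<otimes>\<^bsub>G\<^esub> g" if "g \<in> B" for g
    using that G.generate_pow[OF bG] G.int_pow_commutes[OF bG] unfolding assms(14) by auto
  \<comment> \<open>In \<open>g = a h\<close> the factor \<open>h\<close> commutes with
    \<open>b\<close>, so \<open>a\<close> does too and is trivial by hypothesis.\<close>
  have centralizer_b: "g \<in> B" if g: "g \<in> carrier G" "g \<otimes>\<^bsub>G\<^esub> b = b \<otimes>\<^bsub>G\<^esub> g" for g
  proof -
    obtain a h where ah: "a \<in> A" "h \<in> B" "g = a \<otimes>\<^bsub>G\<^esub> h"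
      using g(1) assms(20) unfolding set_mult_def by blast
    have G': "a \<in> carrier G" "h \<in> carrier G"
      using ah A.mem_carrier subgroup.mem_carrier[OF subB] by auto
    have "(a \<otimes>\<^bsub>G\<^esub> b) \<otimes>\<^bsub>G\<^esub> h = (b \<otimes>\<^bsub>G\<^esub> a) \<otimes>\<^bsub>G\<^esub> h"
      using g(2) B_comm[OF ah(2)] G' bG by (simp add: ah(3) G.m_assoc)
    then have "a \<otimes>\<^bsub>G\<^esub> b = b \<otimes>\<^bsub>G\<^esub> a" using G' bG by simp
    then have "a \<in> centralizer_in G A b" using ah(1) by (simp add: centralizer_in_def)
    then show ?thesis using assms(21) ah G' by simp
  qed

  \<comment> \<open>Characteristic \<open>p\<close> and the invertible scalars \<open>q\<close> and
    2\<close>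
  have finF: "finite (carrier F)"
    using assms(4) p0 by (metis order_def card.infinite zero_less_power less_irrefl)
  have charF: "[p] \<cdot>\<^bsub>F\<^esub> \<one>\<^bsub>F\<^esub> = \<zero>\<^bsub>F\<^esub>" by (rule F.prime_char_of_order[OF assms(4) p0])
  have nonzero: "[l] \<cdot>\<^bsub>F\<^esub> \<one>\<^bsub>F\<^esub> \<noteq> \<zero>\<^bsub>F\<^esub>" if "coprime p l" for l :: nat
    using F.add.pow_eq_one_coprime[of "\<one>\<^bsub>F\<^esub>" p l] charF that by auto
  have "coprime p q"
  proof -
    \<comment> \<open>\<open>p ^ f\<close> leaves remainder 1 on division by \<open>q\<close>, so
      \<open>q\<close> cannot be \<open>p\<close>; here \<open>f\<close> is nonzero because
      \<open>s * q ^ m\<close> is positive.\<close>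
    have "\<not> q dvd p ^ f" using assms(9,10) q1
      by (metis dvd_add_right_iff dvd_mult dvd_power nat_dvd_1_iff_1 less_irrefl)
    moreover have "f \<noteq> 0" using assms(8,10) q0 by (intro notI) simp
    ultimately have "q \<noteq> p" by (metis dvd_power gr0I)
    then show ?thesis using p q by (simp add: primes_coprime)
  qed
  then have q_unit: "[q] \<cdot>\<^bsub>F\<^esub> \<one>\<^bsub>F\<^esub> \<in> Units F" using nonzero by (simp add: F.field_Units)
  have two: "\<one>\<^bsub>F\<^esub> \<oplus>\<^bsub>F\<^esub> \<one>\<^bsub>F\<^esub> \<noteq> \<zero>\<^bsub>F\<^esub>"
  proof -
    have "coprime p 2" using assms(2) by simp
    then show ?thesis using nonzero[of 2] by (simp add: numeral_2_eq_2)
  qed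

  \<comment> \<open>Kept general in \<open>z\<close>, as the two cases below use roots obtained
    differently.\<close>
  have idempotents: "cyclic_idempotents F R scalar q z (inv\<^bsub>F\<^esub> z) (inv\<^bsub>F\<^esub> ([q] \<cdot>\<^bsub>F\<^esub> \<one>\<^bsub>F\<^esub>)) (emb b)"
    if z: "z \<in> carrier F" "z [^]\<^bsub>F\<^esub> q = \<one>\<^bsub>F\<^esub>" "\<And>i. 0 < i \<Longrightarrow> i < q \<Longrightarrow> z [^]\<^bsub>F\<^esub> (i::nat) \<noteq> \<one>\<^bsub>F\<^esub>"
    for z
  proof -
    have zU: "z \<in> Units F" using F.pow_eq_one_Units[OF z(1,2) q0] .
    show ?thesis
    proof
      show "emb b [^]\<^bsub>R\<^esub> q = \<one>\<^bsub>R\<^esub>" using B_pow[OF bB] bG by (simp add: emb_pow emb_one)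
      show "inv\<^bsub>F\<^esub> ([q] \<cdot>\<^bsub>F\<^esub> \<one>\<^bsub>F\<^esub>) \<otimes>\<^bsub>F\<^esub> ([q] \<cdot>\<^bsub>F\<^esub> \<one>\<^bsub>F\<^esub>) = \<one>\<^bsub>F\<^esub>"
        using q_unit by (rule F.Units_l_inv)
      show "z \<otimes>\<^bsub>F\<^esub> inv\<^bsub>F\<^esub> z = \<one>\<^bsub>F\<^esub>" using zU by (rule F.Units_r_inv)
    qed (use z zU q_unit in \<open>auto intro: scalar_central\<close>)
  qed

  show False
  proof (cases "n = 0")

    \<comment> \<open>Nontrivial \<open>A\<close>: lifting an element of \<open>A\<close> into the
      centralizer of \<open>b\<close>\<close>
    case False
    have A_pow: "a [^]\<^bsub>G\<^esub> (p ^ n) = \<one>\<^bsub>G\<^esub>" if "a \<in> A" for a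
    proof -
      interpret GA: comm_group "G\<lparr>carrier := A\<rparr>" by fact
      show ?thesis using GA.pow_order_eq_1[of a] that assms(18)
        by (simp add: order_def nat_pow_def)
    qed
    have A_comm: "a \<otimes>\<^bsub>G\<^esub> a' = a' \<otimes>\<^bsub>G\<^esub> a" if "a \<in> A" "a' \<in> A" for a a'
      using comm_monoid.m_comm[of "G\<lparr>carrier := A\<rparr>" a a'] assms(17) that
      by (simp add: comm_group_def)
    obtain P where P: "P \<lhd> V" "emb ` A \<subseteq> P"
      and P_pow: "\<And>x. x \<in> P \<Longrightarrow> \<exists>j. x [^]\<^bsub>V\<^esub> (p ^ j) = \<one>\<^bsub>V\<^esub>"
      using normal_p_subgroup_of_units[OF V p charF finF \<open>A \<lhd> G\<close> A_comm A_pow] by blast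
    obtain z where z: "z \<in> carrier F" "z [^]\<^bsub>F\<^esub> q = \<one>\<^bsub>F\<^esub>"
      "\<And>i. 0 < i \<Longrightarrow> i < q \<Longrightarrow> z [^]\<^bsub>F\<^esub> (i::nat) \<noteq> \<one>\<^bsub>F\<^esub>"
      using F.ex_primitive_root[OF finF, of q] assms(4,7) by auto
    interpret E: cyclic_idempotents F R scalar q z "inv\<^bsub>F\<^esub> z" "inv\<^bsub>F\<^esub> ([q] \<cdot>\<^bsub>F\<^esub> \<one>\<^bsub>F\<^esub>)" "emb b"
      by (rule idempotents[OF z])
    have comm_b: "emb b \<otimes>\<^bsub>R\<^esub> E.reflection i = E.reflection i \<otimes>\<^bsub>R\<^esub> emb b" for i
      using E.commutes_idem[of "emb b"] by (simp add: E.reflection_commutes_iff two)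
    have refl_V: "E.reflection i \<in> carrier V" if "0 < i" "i < q" for i
    proof -
      have "augmentation F G (E.idem i) = \<zero>\<^bsub>F\<^esub>"
        using augmentation_hom that bG
        by (intro E.hom_idem) (auto simp: augmentation_emb augmentation_monomial)
      then have "augmentation F G (E.reflection i) = \<one>\<^bsub>F\<^esub>"
        by (simp add: E.reflection_def R.minus_eq)
      moreover have "E.reflection i \<in> Units R"
        using R.pow_eq_one_Units[of "E.reflection i" 2] by (simp add: numeral_2_eq_2 E.reflection_reflection)
      ultimately show ?thesis by simp
    qed
    \<comment> \<open>The image commutes with \<open>b\<close>, hence lies in \<open>B\<close> and
      has order dividing the odd \<open>q\<close>; its square is trivial as well.\<close>
    have r_refl: "r (E.reflection i) = \<one>\<^bsub>G\<^esub>" if i: "0 < i" "i < q" for i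
    proof -
      let ?w = "E.reflection i"
      have w: "?w \<in> carrier V" "emb b \<in> carrier V" using refl_V[OF i] emb_hom bG by (auto simp: hom_def)
      have rw: "r ?w \<in> carrier G" using w by (rule_tac r.hom_closed)
      have "r (?w \<otimes>\<^bsub>V\<^esub> emb b) = r (emb b \<otimes>\<^bsub>V\<^esub> ?w)" using comm_b[of i] by simp
      then have "r ?w \<otimes>\<^bsub>G\<^esub> b = b \<otimes>\<^bsub>G\<^esub> r ?w"
        using w bG by (simp only: r.hom_mult r_emb)
      then have "r ?w [^]\<^bsub>G\<^esub> q = \<one>\<^bsub>G\<^esub>" using rw centralizer_b B_pow by blast
      moreover have "r ?w [^]\<^bsub>G\<^esub> (2::nat) = \<one>\<^bsub>G\<^esub>"
      proof -
        have "r (?w \<otimes>\<^bsub>V\<^esub> ?w) = r \<one>\<^bsub>V\<^esub>" by (simp add: E.reflection_reflection)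
        then have "r ?w \<otimes>\<^bsub>G\<^esub> r ?w = \<one>\<^bsub>G\<^esub>" using w by (simp only: r.hom_mult r.hom_one)
        then show ?thesis using rw by (simp add: numeral_2_eq_2)
      qed
      ultimately show ?thesis using G.pow_eq_one_coprime[OF rw] assms(6) by (simp add: coprime_commute)
    qed
    have "card A > 1" using assms(18) False prime_gt_1_nat[OF p] by (metis gr0I one_less_power)
    then obtain a where a: "a \<in> A" "a \<noteq> \<one>\<^bsub>G\<^esub>"
      by (metis card_le_Suc0_iff_eq finA One_nat_def not_le)
    have aG: "a \<in> carrier G" using a A.mem_carrier by simp
    \<comment> \<open>The involutions commute with one another since each commutes with
      \<open>b\<close> and hence with every \<open>idem j\<close>. The odd exponents required for
      \<open>P\<close> are powers of \<open>p\<close>.\<close>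
    have "\<exists>c\<in>P. r c = r (emb a) \<and> (\<forall>w\<in>E.reflection ` {0<..<q}. w \<otimes>\<^bsub>V\<^esub> c = c \<otimes>\<^bsub>V\<^esub> w)"
    proof (rule r.commuting_lift[OF P(1)])
      show "\<exists>d::nat. odd d \<and> x [^]\<^bsub>V\<^esub> d = \<one>\<^bsub>V\<^esub>" if "x \<in> P" for x
        using P_pow[OF that] assms(2) by (metis even_power)
      show "emb a \<in> P" using P(2) a by auto
      show "v \<otimes>\<^bsub>V\<^esub> w = w \<otimes>\<^bsub>V\<^esub> v" if vw: "v \<in> E.reflection ` {0<..<q}" "w \<in> E.reflection ` {0<..<q}" for v w
      proof -
        obtain i j where ij: "v = E.reflection i" "w = E.reflection j" using vw by blast
        have "v \<otimes>\<^bsub>R\<^esub> E.idem j = E.idem j \<otimes>\<^bsub>R\<^esub> v"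
          using E.commutes_idem[of v j] comm_b[of i] by (simp add: ij)
        then show ?thesis by (simp add: ij E.reflection_commutes_iff[OF _ two])
      qed
    qed (use refl_V r_refl in \<open>auto simp: E.reflection_reflection\<close>)
    then obtain c where c: "c \<in> P" "r c = a" "\<And>i. 0 < i \<Longrightarrow> i < q \<Longrightarrow> E.reflection i \<otimes>\<^bsub>R\<^esub> c = c \<otimes>\<^bsub>R\<^esub> E.reflection i"
      using r_emb[OF aG] by auto
    interpret P: normal P V by (rule P)
    have cV: "c \<in> carrier V" using c(1) by (rule P.mem_carrier)
    then have cR: "c \<in> carrier R" by (simp add: R.Units_closed)
    have "c \<otimes>\<^bsub>R\<^esub> emb b = emb b \<otimes>\<^bsub>R\<^esub> c"
    proof (rule E.commutes_b[OF cR])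
      fix i assume "0 < i" "i < q"
      then show "c \<otimes>\<^bsub>R\<^esub> E.idem i = E.idem i \<otimes>\<^bsub>R\<^esub> c"
        using c(3)[of i] E.reflection_commutes_iff[OF cR two, of i] by simp
    qed
    \<comment> \<open>Applying the retraction carries the commutation of \<open>c\<close> with
      \<open>b\<close> over to \<open>a\<close>, contradicting the choice of \<open>a\<close> as a
      nontrivial element of \<open>A\<close>.\<close>
    then have "r (c \<otimes>\<^bsub>V\<^esub> emb b) = r (emb b \<otimes>\<^bsub>V\<^esub> c)" by simp
    moreover have "emb b \<in> carrier V" using emb_hom bG unfolding hom_def by blast
    ultimately have "a \<otimes>\<^bsub>G\<^esub> b = b \<otimes>\<^bsub>G\<^esub> a"
      using cV bG by (simp only: r.hom_mult r_emb c(2))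
    then have "a \<in> centralizer_in G A b" using a by (simp add: centralizer_in_def)
    then show False using assms(21) a by simp
  next

    \<comment> \<open>Trivial \<open>A\<close>: a \<open>q\<close>-th root of \<open>b\<close> among
      the normalized units\<close>
    case True
    have "f \<noteq> 0" using assms(8,10) q0 by (intro notI) simp
    \<comment> \<open>For \<open>n = 0\<close> the alternative fails, because
      \<open>f * (q - 1)\<close> is positive.\<close>
    then have "m > 1" using assms(22) True q1 by auto
    then have "q * q dvd p ^ f - 1"
      using assms(10) le_imp_power_dvd[of 2 m q] by (simp add: power2_eq_square)
    then obtain y where y: "y \<in> carrier F" "y [^]\<^bsub>F\<^esub> (q * q) = \<one>\<^bsub>F\<^esub>"
      "\<And>i. 0 < i \<Longrightarrow> i < q * q \<Longrightarrow> y [^]\<^bsub>F\<^esub> (i::nat) \<noteq> \<one>\<^bsub>F\<^esub>"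
      using F.ex_primitive_root[OF finF, of "q * q"] assms(4) by auto
    \<comment> \<open>As \<open>y\<close> has order \<open>q * q\<close>, its \<open>q\<close>-th
      power is a primitive \<open>q\<close>-th root of unity that visibly has a \<open>q\<close>-th
      root.\<close>
    let ?z = "y [^]\<^bsub>F\<^esub> q"
    interpret E: cyclic_idempotents F R scalar q ?z "inv\<^bsub>F\<^esub> ?z" "inv\<^bsub>F\<^esub> ([q] \<cdot>\<^bsub>F\<^esub> \<one>\<^bsub>F\<^esub>)" "emb b"
    proof (rule idempotents)
      show "?z [^]\<^bsub>F\<^esub> i \<noteq> \<one>\<^bsub>F\<^esub>" if "0 < i" "i < q" for i :: nat
        using y(1) y(3)[of "q * i"] that q0 by (simp add: F.nat_pow_pow)
    qed (use y in \<open>auto simp: F.nat_pow_pow\<close>)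
    obtain u where u: "u \<in> carrier R" "u [^]\<^bsub>R\<^esub> q = emb b"
      using E.ex_root[OF y(1)] by blast
    \<comment> \<open>The root \<open>u\<close> need not have augmentation one, but its augmentation
      is a \<open>q\<close>-th root of unity. Dividing by it normalizes \<open>u\<close> without
      changing the \<open>q\<close>-th power.\<close>
    define c where "c = augmentation F G u"
    have c: "c \<in> carrier F" "c [^]\<^bsub>F\<^esub> q = \<one>\<^bsub>F\<^esub>"
      using u bG aug.hom_nat_pow[OF u(1), of q] by (auto simp: c_def augmentation_emb)
    then have cU: "c \<in> Units F" using q0 by (rule F.pow_eq_one_Units)
    let ?c = "inv\<^bsub>F\<^esub> c"
    have c'F: "?c \<in> carrier F" using cU by simp
    have "c [^]\<^bsub>F\<^esub> q \<otimes>\<^bsub>F\<^esub> ?c [^]\<^bsub>F\<^esub> q = \<one>\<^bsub>F\<^esub>"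
      using c cU c'F by (subst F.nat_pow_distrib[symmetric]) auto
    then have c': "?c [^]\<^bsub>F\<^esub> q = \<one>\<^bsub>F\<^esub>" using c c'F by simp
    define v where "v = scalar ?c \<otimes>\<^bsub>R\<^esub> u"
    have vR: "v \<in> carrier R" using c'F u by (simp add: v_def)
    have "v [^]\<^bsub>R\<^esub> q = scalar ?c [^]\<^bsub>R\<^esub> q \<otimes>\<^bsub>R\<^esub> u [^]\<^bsub>R\<^esub> q"
      unfolding v_def using c'F u(1) by (intro R.pow_mult_distrib scalar_central) auto
    also have "scalar ?c [^]\<^bsub>R\<^esub> q = scalar (?c [^]\<^bsub>F\<^esub> q)"
      using c'F by (simp only: sc.hom_nat_pow)
    finally have v_pow: "v [^]\<^bsub>R\<^esub> q = emb b" using c' u by simp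
    have "v [^]\<^bsub>R\<^esub> (q * q) = \<one>\<^bsub>R\<^esub>"
      using vR v_pow E.b_pow by (simp add: R.nat_pow_pow[symmetric])
    then have "v \<in> Units R" using vR q0 by (intro R.pow_eq_one_Units[of v "q * q"]) auto
    moreover have "augmentation F G v = \<one>\<^bsub>F\<^esub>"
      using c'F u cU by (simp add: v_def augmentation_monomial c_def[symmetric])
    ultimately have vV: "v \<in> carrier V" by simp
    have "A = {\<one>\<^bsub>G\<^esub>}"
      using assms(18) True subgroup.one_closed[OF A.subgroup_axioms]
      by (metis card_1_singletonE power_0 singletonD)
    then obtain h where h: "h \<in> B" "r v = \<one>\<^bsub>G\<^esub> \<otimes>\<^bsub>G\<^esub> h"
      using r.hom_closed[OF vV] unfolding assms(20)[symmetric] set_mult_def by blast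
    then have "r v \<in> B" using subgroup.mem_carrier[OF subB] by simp
    \<comment> \<open>Now \<open>G\<close> equals \<open>B\<close>, where all \<open>q\<close>-th
      powers are trivial, so \<open>b\<close> itself is trivial although it generates a group of
      order \<open>q\<close>.\<close>
    have "b = r (v [^]\<^bsub>V\<^esub> q)" using v_pow r_emb[OF bG] by simp
    also have "\<dots> = r v [^]\<^bsub>G\<^esub> q" using vV by (rule r.hom_nat_pow)
    also have "\<dots> = \<one>\<^bsub>G\<^esub>" using \<open>r v \<in> B\<close> by (rule B_pow)
    finally have "B = {\<one>\<^bsub>G\<^esub>}" using assms(14) G.generate_one by simp
    then show False using assms(15) q1 by simp
  qed
qed

end
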